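(* Let $G$ be a simple graph on $l$ vertices, with vertex set $\Pi$, let $\mathfrak{g}$ be the Kac-Moody algebra with Dynkin diagram $G$, and let $\widetilde\chi(G;q):=(-1)^l\,\chi(G;-q)$, where $\chi(G;q)$ is the chromatic polynomial of $G$. Then $$\widetilde\chi(G;q)=K(\beta(\Pi);q),$$ where $K(\,\cdot\,;q)$ is the $q$-Kostant partition function of $\mathfrak{g}$ and $\beta(\Pi)=\sum_{\alpha\in\Pi}\alpha$.
   Context: $G$ is a simple graph on $l$ vertices, not assumed connected. Let $A$ be its adjacency matrix and $B:=2I-A$, a symmetric generalized Cartan matrix. $\mathfrak{g}$ is the complex Kac-Moody Lie algebra constructed from $B$ (generated by a Cartan subalgebra $\mathfrak{h}$ from a minimal realization of $B$ and Chevalley generators $e_i,f_i$ subject to the Chevalley-Serre relations). Its root space decomposition is $\mathfrak{g}=\mathfrak{h}\oplus\bigoplus_{\alpha\in\Delta_+}(\mathfrak{g}_\alpha\oplus\mathfrak{g}_{-\alpha})$ with $\Delta_+$ the set of positive roots; $\operatorname{mult}\alpha:=\dim\mathfrak{g}_\alpha$. The set $\Pi$ of simple roots is identified with the vertex set of $G$. The chromatic polynomial $\chi(G;q)$ is the polynomial in $q$ whose value at each positive integer $q$ is the number of proper vertex colorings of $G$ with $q$ colors. The $q$-Kostant partition function $K(\beta;q)$ is the coefficient of $e^{\beta}$ in the product $\prod_{\alpha\in\Delta_+}(1-q\,e^{\alpha})^{-\operatorname{mult}\alpha}$ (expanded as a formal power series in the $e^{\alpha}$, $\alpha\in\Pi$).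 *)

theory Defs
  imports
    "HOL-Analysis.Analysis"
    "HOL-Library.Multiset"
    "HOL-Computational_Algebra.Polynomial"
begin

section \<open>Simple graphs and chromatic polynomials\<close>

text \<open>The vertex set is a finite type \<open>'v\<close>; a graph is given by its adjacency relation.\<close>

definition simple_graph :: "('v \<Rightarrow> 'v \<Rightarrow> bool) \<Rightarrow> bool" where
  "simple_graph E \<longleftrightarrow> symp E \<and> irreflp E"

definition proper_colorings :: "('v \<Rightarrow> 'v \<Rightarrow> bool) \<Rightarrow> nat \<Rightarrow> ('v \<Rightarrow> nat) set" where
  "proper_colorings E q = {c. range c \<subseteq> {..<q} \<and> (\<forall>u v. E u v \<longrightarrow> c u \<noteq> c v)}"

definition chromatic_poly :: "('v \<Rightarrow> 'v \<Rightarrow> bool) \<Rightarrow> int poly" where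
  "chromatic_poly E =
     (THE p. \<forall>q>0. poly p (int q) = int (card (proper_colorings E q)))"

definition chromatic_poly_tilde :: "('v::finite \<Rightarrow> 'v \<Rightarrow> bool) \<Rightarrow> int poly" where
  "chromatic_poly_tilde E = (- 1) ^ CARD('v) * (chromatic_poly E \<circ>\<^sub>p [:0, - 1:])"


section \<open>Multivariate formal power series\<close>

text \<open>
  Power series in indeterminates indexed by \<open>'v\<close>. The monomial with exponent vector
  \<open>(n\<^sub>v)\<close> is encoded as the multiset in which each \<open>v\<close> has multiplicity \<open>n\<^sub>v\<close>, so that
  multiplication of monomials is the sum of multisets.
\<close>

typedef ('v, 'c) mfps = "UNIV :: ('v multiset \<Rightarrow> 'c) set"
  morphisms mfps_coeff Abs_mfps ..

setup_lifting type_definition_mfps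

lemma mfps_coeff_Abs [simp]: "mfps_coeff (Abs_mfps f) = f"
  by (simp add: Abs_mfps_inverse)

lemma mfps_eqI: "(\<And>\<beta>. mfps_coeff f \<beta> = mfps_coeff g \<beta>) \<Longrightarrow> f = g"
  by (metis ext mfps_coeff_inject)

lemma finite_mset_summands: "finite {(\<gamma>, \<delta>). \<gamma> + \<delta> = (\<beta> :: 'v multiset)}"
proof (rule finite_subset)
  let ?S = "mset ` {xs. set xs \<subseteq> set_mset \<beta> \<and> length xs \<le> size \<beta>}"
  show "finite (?S \<times> ?S)"
    by (intro finite_cartesian_product finite_imageI finite_lists_length_le) auto
  have *: "\<gamma> \<in> ?S" if sub: "\<gamma> \<subseteq># \<beta>" for \<gamma>
  proof -
    obtain xs where xs: "mset xs = \<gamma>" using ex_mset by blast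
    have "set xs \<subseteq> set_mset \<beta>" using set_mset_mono[OF sub] xs by auto
    moreover have "length xs \<le> size \<beta>" using size_mset_mono[OF sub] xs by auto
    ultimately show ?thesis using xs by blast
  qed
  show "{(\<gamma>, \<delta>). \<gamma> + \<delta> = \<beta>} \<subseteq> ?S \<times> ?S"
  proof
    fix p assume "p \<in> {(\<gamma>, \<delta>). \<gamma> + \<delta> = \<beta>}"
    then have "fst p \<subseteq># \<beta>" "snd p \<subseteq># \<beta>" by auto
    then show "p \<in> ?S \<times> ?S" using *[of "fst p"] *[of "snd p"] unfolding mem_Times_iff by blast
  qed
qed

instantiation mfps :: (type, comm_ring_1) comm_ring_1
begin

lift_definition zero_mfps :: "('a, 'b) mfps" is "\<lambda>_. 0" .
lift_definition one_mfps :: "('a, 'b) mfps" is "\<lambda>\<beta>. if \<beta> = {#} then 1 else 0" .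
lift_definition plus_mfps :: "('a, 'b) mfps \<Rightarrow> ('a, 'b) mfps \<Rightarrow> ('a, 'b) mfps"
  is "\<lambda>f g \<beta>. f \<beta> + g \<beta>" .
lift_definition minus_mfps :: "('a, 'b) mfps \<Rightarrow> ('a, 'b) mfps \<Rightarrow> ('a, 'b) mfps"
  is "\<lambda>f g \<beta>. f \<beta> - g \<beta>" .
lift_definition uminus_mfps :: "('a, 'b) mfps \<Rightarrow> ('a, 'b) mfps" is "\<lambda>f \<beta>. - f \<beta>" .
lift_definition times_mfps :: "('a, 'b) mfps \<Rightarrow> ('a, 'b) mfps \<Rightarrow> ('a, 'b) mfps"
  is "\<lambda>f g \<beta>. \<Sum>(\<gamma>, \<delta>) \<in> {(\<gamma>, \<delta>). \<gamma> + \<delta> = \<beta>}. f \<gamma> * g \<delta>" .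

instance
proof
  fix f g h :: "('a, 'b) mfps"
  show "f + g + h = f + (g + h)" by transfer (simp add: add.assoc)
  show "f + g = g + f" by transfer (simp add: add.commute)
  show "0 + f = f" by transfer simp
  show "- f + f = 0" by transfer simp
  show "f - g = f + - g" by transfer simp
  show "(0 :: ('a, 'b) mfps) \<noteq> 1" by transfer (auto simp: fun_eq_iff)
  show "(f + g) * h = f * h + g * h"
    by transfer (simp add: split_def distrib_right sum.distrib)
  show "f * g = g * f"
  proof (transfer, rule ext)
    fix f g :: "'a multiset \<Rightarrow> 'b" and \<beta>
    show "(\<Sum>(\<gamma>, \<delta>) \<in> {(\<gamma>, \<delta>). \<gamma> + \<delta> = \<beta>}. f \<gamma> * g \<delta>) =
          (\<Sum>(\<gamma>, \<delta>) \<in> {(\<gamma>, \<delta>). \<gamma> + \<delta> = \<beta>}. g \<gamma> * f \<delta>)"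
      by (rule sum.reindex_bij_witness[of _ prod.swap prod.swap])
         (auto simp: add.commute mult.commute)
  qed
  show "1 * f = f"
  proof (transfer, rule ext)
    fix f :: "'a multiset \<Rightarrow> 'b" and \<beta>
    have "(\<Sum>(\<gamma>, \<delta>) \<in> {(\<gamma>, \<delta>). \<gamma> + \<delta> = \<beta>}. (if \<gamma> = {#} then 1 else 0) * f \<delta>) =
          (\<Sum>(\<gamma>, \<delta>) \<in> {({#} :: 'a multiset, \<beta>)}. (if \<gamma> = {#} then 1 else 0) * f \<delta>)"
      by (rule sum.mono_neutral_right[OF finite_mset_summands]) (auto split: if_splits)
    then show "(\<Sum>(\<gamma>, \<delta>) \<in> {(\<gamma>, \<delta>). \<gamma> + \<delta> = \<beta>}. (if \<gamma> = {#} then 1 else 0) * f \<delta>) = f \<beta>"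
      by simp
  qed
  show "f * g * h = f * (g * h)"
  proof (transfer, rule ext)
    fix f g h :: "'a multiset \<Rightarrow> 'b" and \<beta>
    let ?P = "\<lambda>\<beta>. {(\<gamma>, \<delta>). \<gamma> + \<delta> = (\<beta> :: 'a multiset)}"
    have "(\<Sum>(\<gamma>, \<delta>) \<in> ?P \<beta>. (\<Sum>(\<mu>, \<nu>) \<in> ?P \<gamma>. f \<mu> * g \<nu>) * h \<delta>) =
          (\<Sum>(x, y) \<in> Sigma (?P \<beta>) (\<lambda>x. ?P (fst x)). f (fst y) * g (snd y) * h (snd x))"
      by (simp add: sum.Sigma finite_mset_summands[unfolded split_def] split_def sum_distrib_right)
    also have "\<dots> =
          (\<Sum>(x, y) \<in> Sigma (?P \<beta>) (\<lambda>x. ?P (snd x)). f (fst x) * (g (fst y) * h (snd y)))"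
      by (rule sum.reindex_bij_witness
            [of _ "\<lambda>((a, bc), (b, c)). ((a + b, c), (a, b))"
                  "\<lambda>((ab, c), (a, b)). ((a, b + c), (b, c))"])
         (auto simp: algebra_simps)
    also have "\<dots> = (\<Sum>(\<gamma>, \<delta>) \<in> ?P \<beta>. f \<gamma> * (\<Sum>(\<mu>, \<nu>) \<in> ?P \<delta>. g \<mu> * h \<nu>))"
      by (simp add: sum.Sigma finite_mset_summands[unfolded split_def] split_def sum_distrib_left)
    finally show "(\<Sum>(\<gamma>, \<delta>) \<in> ?P \<beta>. (\<Sum>(\<mu>, \<nu>) \<in> ?P \<gamma>. f \<mu> * g \<nu>) * h \<delta>) =
      (\<Sum>(\<gamma>, \<delta>) \<in> ?P \<beta>. f \<gamma> * (\<Sum>(\<mu>, \<nu>) \<in> ?P \<delta>. g \<mu> * h \<nu>))" .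
  qed
qed

end

instantiation mfps :: (type, comm_ring_1) inverse
begin

definition inverse_mfps :: "('a, 'b) mfps \<Rightarrow> ('a, 'b) mfps" where
  "inverse_mfps f = (if \<exists>g. f * g = 1 then THE g. f * g = 1 else 0)"

definition divide_mfps :: "('a, 'b) mfps \<Rightarrow> ('a, 'b) mfps \<Rightarrow> ('a, 'b) mfps" where
  "divide_mfps f g = f * inverse g"

instance ..

end

definition mfps_monom :: "'c::zero \<Rightarrow> 'v multiset \<Rightarrow> ('v, 'c) mfps" where
  "mfps_monom c \<alpha> = Abs_mfps (\<lambda>\<beta>. if \<beta> = \<alpha> then c else 0)"

text \<open>
  Coefficient of a possibly infinite product: the value at which the coefficients of the
  finite partial products stabilise, i.e. convergence is coefficientwise.
\<close>

definition mfps_infprod_coeff ::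
  "('i \<Rightarrow> ('v, 'c::comm_ring_1) mfps) \<Rightarrow> 'i set \<Rightarrow> 'v multiset \<Rightarrow> 'c" where
  "mfps_infprod_coeff f A \<beta> =
     (THE c. \<forall>\<^sub>F F in finite_subsets_at_top A. mfps_coeff (\<Prod>\<alpha>\<in>F. f \<alpha>) \<beta> = c)"


section \<open>Lie algebras given by generators and relations\<close>

locale lie_algebra = vector_space scaleG
  for scaleG :: "complex \<Rightarrow> 'g::ab_group_add \<Rightarrow> 'g" +
  fixes br :: "'g \<Rightarrow> 'g \<Rightarrow> 'g"
  assumes br_add_left: "br (x + y) z = br x z + br y z"
    and br_add_right: "br x (y + z) = br x y + br x z"
    and br_scale_left: "br (scaleG c x) y = scaleG c (br x y)"
    and br_scale_right: "br x (scaleG c y) = scaleG c (br x y)"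
    and br_self: "br x x = 0"
    and jacobi: "br x (br y z) + br y (br z x) + br z (br x y) = 0"

datatype 'x lie_expr =
    Gen 'x
  | LZero
  | LAdd "'x lie_expr" "'x lie_expr"
  | LScale complex "'x lie_expr"
  | LBr "'x lie_expr" "'x lie_expr"

primrec lie_eval ::
  "(complex \<Rightarrow> 'g \<Rightarrow> 'g) \<Rightarrow> ('g \<Rightarrow> 'g \<Rightarrow> 'g) \<Rightarrow> ('x \<Rightarrow> 'g) \<Rightarrow> 'x lie_expr \<Rightarrow> 'g::ab_group_add"
where
  "lie_eval scaleG br \<gamma> (Gen x) = \<gamma> x"
| "lie_eval scaleG br \<gamma> LZero = 0"
| "lie_eval scaleG br \<gamma> (LAdd s t) = lie_eval scaleG br \<gamma> s + lie_eval scaleG br \<gamma> t"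
| "lie_eval scaleG br \<gamma> (LScale c t) = scaleG c (lie_eval scaleG br \<gamma> t)"
| "lie_eval scaleG br \<gamma> (LBr s t) = br (lie_eval scaleG br \<gamma> s) (lie_eval scaleG br \<gamma> t)"

text \<open>
  \<open>lie_derivable R s t\<close>: the equation \<open>s = t\<close> follows from the equations in \<open>R\<close> and the
  axioms of complex Lie algebras. The quotient of the expressions by this congruence is the
  free Lie algebra on \<open>'x\<close> modulo the ideal generated by the differences \<open>s - t\<close> with
  \<open>(s, t) \<in> R\<close>.
\<close>

inductive lie_derivable ::
  "('x lie_expr \<times> 'x lie_expr) set \<Rightarrow> 'x lie_expr \<Rightarrow> 'x lie_expr \<Rightarrow> bool"
  for R
where
  rel: "(s, t) \<in> R \<Longrightarrow> lie_derivable R s t"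
| refl: "lie_derivable R s s"
| sym: "lie_derivable R s t \<Longrightarrow> lie_derivable R t s"
| trans: "lie_derivable R s t \<Longrightarrow> lie_derivable R t u \<Longrightarrow> lie_derivable R s u"
| cong_add: "lie_derivable R s s' \<Longrightarrow> lie_derivable R t t' \<Longrightarrow>
    lie_derivable R (LAdd s t) (LAdd s' t')"
| cong_scale: "lie_derivable R s s' \<Longrightarrow> lie_derivable R (LScale c s) (LScale c s')"
| cong_br: "lie_derivable R s s' \<Longrightarrow> lie_derivable R t t' \<Longrightarrow>
    lie_derivable R (LBr s t) (LBr s' t')"
| add_assoc: "lie_derivable R (LAdd (LAdd s t) u) (LAdd s (LAdd t u))"
| add_comm: "lie_derivable R (LAdd s t) (LAdd t s)"
| add_zero: "lie_derivable R (LAdd s LZero) s"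
| add_neg: "lie_derivable R (LAdd s (LScale (- 1) s)) LZero"
| scale_add: "lie_derivable R (LScale c (LAdd s t)) (LAdd (LScale c s) (LScale c t))"
| add_scale: "lie_derivable R (LScale (c + d) s) (LAdd (LScale c s) (LScale d s))"
| scale_scale: "lie_derivable R (LScale c (LScale d s)) (LScale (c * d) s)"
| scale_one: "lie_derivable R (LScale 1 s) s"
| br_add_left: "lie_derivable R (LBr (LAdd s t) u) (LAdd (LBr s u) (LBr t u))"
| br_add_right: "lie_derivable R (LBr s (LAdd t u)) (LAdd (LBr s t) (LBr s u))"
| br_scale_left: "lie_derivable R (LBr (LScale c s) t) (LScale c (LBr s t))"
| br_scale_right: "lie_derivable R (LBr s (LScale c t)) (LScale c (LBr s t))"
| br_self: "lie_derivable R (LBr s s) LZero"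
| jacobi: "lie_derivable R
    (LAdd (LAdd (LBr s (LBr t u)) (LBr t (LBr u s))) (LBr u (LBr s t))) LZero"

text \<open>
  The Lie algebra on \<open>'g\<close> is presented by the generators \<open>'x\<close> (interpreted by \<open>\<gamma>\<close>) and the
  relations \<open>R\<close>: evaluation induces a bijection from expressions modulo derivable equality
  onto \<open>'g\<close>.
\<close>

definition lie_presentation ::
  "(complex \<Rightarrow> 'g::ab_group_add \<Rightarrow> 'g) \<Rightarrow> ('g \<Rightarrow> 'g \<Rightarrow> 'g) \<Rightarrow> ('x \<Rightarrow> 'g) \<Rightarrow>
   ('x lie_expr \<times> 'x lie_expr) set \<Rightarrow> bool"
where
  "lie_presentation scaleG br \<gamma> R \<longleftrightarrow>
     lie_algebra scaleG br \<and>
     surj (lie_eval scaleG br \<gamma>) \<and>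
     (\<forall>s t. lie_eval scaleG br \<gamma> s = lie_eval scaleG br \<gamma> t \<longleftrightarrow> lie_derivable R s t)"


section \<open>Kac-Moody algebras\<close>

definition adjacency_matrix :: "('v::finite \<Rightarrow> 'v \<Rightarrow> bool) \<Rightarrow> int ^ 'v ^ 'v" where
  "adjacency_matrix E = (\<chi> i j. if E i j then 1 else 0)"

definition cartan_matrix :: "('v::finite \<Rightarrow> 'v \<Rightarrow> bool) \<Rightarrow> int ^ 'v ^ 'v" where
  "cartan_matrix E = mat 2 - adjacency_matrix E"

text \<open>
  The Cartan subalgebra of the realization is the whole type \<open>'h\<close>; \<open>\<alpha> i\<close> are the simple
  roots, \<open>h i\<close> the simple coroots.
\<close>

definition minimal_realization ::
  "int ^ 'v ^ 'v \<Rightarrow> (complex \<Rightarrow> 'h::ab_group_add \<Rightarrow> 'h) \<Rightarrow>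
   ('v::finite \<Rightarrow> 'h \<Rightarrow> complex) \<Rightarrow> ('v \<Rightarrow> 'h) \<Rightarrow> bool"
where
  "minimal_realization B scaleH \<alpha> h \<longleftrightarrow>
     (\<exists>basis. finite_dimensional_vector_space scaleH basis \<and>
        card basis = 2 * CARD('v) - rank (\<chi> i j. complex_of_int (B $ i $ j))) \<and>
     (\<forall>i. Vector_Spaces.linear scaleH (*) (\<alpha> i)) \<and>
     (\<forall>c. (\<forall>x. (\<Sum>i\<in>UNIV. c i * \<alpha> i x) = 0) \<longrightarrow> (\<forall>i. c i = 0)) \<and>
     (\<forall>c. (\<Sum>i\<in>UNIV. scaleH (c i) (h i)) = 0 \<longrightarrow> (\<forall>i. c i = 0)) \<and>
     (\<forall>i j. \<alpha> j (h i) = of_int (B $ i $ j))"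

datatype ('h, 'v) km_gen = GenH 'h | GenE 'v | GenF 'v

abbreviation "genH x \<equiv> Gen (GenH x)"
abbreviation "genE i \<equiv> Gen (GenE i)"
abbreviation "genF i \<equiv> Gen (GenF i)"

text \<open>
  The first two relations make \<open>x \<mapsto> genH x\<close> linear, so that the presented Lie algebra is
  generated by the vector space \<open>'h\<close> together with the \<open>e\<^sub>i\<close> and \<open>f\<^sub>i\<close>. The last two are
  \<open>(ad e\<^sub>i)\<^bsup>1 - b\<^sub>i\<^sub>j\<^esup> e\<^sub>j = 0\<close> and \<open>(ad f\<^sub>i)\<^bsup>1 - b\<^sub>i\<^sub>j\<^esup> f\<^sub>j = 0\<close>.
\<close>

inductive_set chevalley_serre_relations ::
  "int ^ 'v ^ 'v \<Rightarrow> (complex \<Rightarrow> 'h::ab_group_add \<Rightarrow> 'h) \<Rightarrow> ('v::finite \<Rightarrow> 'h \<Rightarrow> complex) \<Rightarrow>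
   ('v \<Rightarrow> 'h) \<Rightarrow> (('h, 'v) km_gen lie_expr \<times> ('h, 'v) km_gen lie_expr) set"
  for B scaleH \<alpha> h
where
  H_add: "(genH (x + y), LAdd (genH x) (genH y)) \<in> chevalley_serre_relations B scaleH \<alpha> h"
| H_scale: "(genH (scaleH c x), LScale c (genH x)) \<in> chevalley_serre_relations B scaleH \<alpha> h"
| HH: "(LBr (genH x) (genH y), LZero) \<in> chevalley_serre_relations B scaleH \<alpha> h"
| HE: "(LBr (genH x) (genE i), LScale (\<alpha> i x) (genE i))
        \<in> chevalley_serre_relations B scaleH \<alpha> h"
| HF: "(LBr (genH x) (genF i), LScale (- \<alpha> i x) (genF i))
        \<in> chevalley_serre_relations B scaleH \<alpha> h"
| EF: "(LBr (genE i) (genF j), if i = j then genH (h i) else LZero)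
        \<in> chevalley_serre_relations B scaleH \<alpha> h"
| serre_E: "i \<noteq> j \<Longrightarrow> ((LBr (genE i) ^^ nat (1 - B $ i $ j)) (genE j), LZero)
        \<in> chevalley_serre_relations B scaleH \<alpha> h"
| serre_F: "i \<noteq> j \<Longrightarrow> ((LBr (genF i) ^^ nat (1 - B $ i $ j)) (genF j), LZero)
        \<in> chevalley_serre_relations B scaleH \<alpha> h"

text \<open>
  \<open>\<iota>\<close> is the canonical map from \<open>'h\<close> into the algebra, \<open>e\<close> and \<open>f\<close> are the Chevalley
  generators.
\<close>

definition kac_moody_algebra ::
  "int ^ 'v ^ 'v \<Rightarrow> (complex \<Rightarrow> 'h::ab_group_add \<Rightarrow> 'h) \<Rightarrow> ('v::finite \<Rightarrow> 'h \<Rightarrow> complex) \<Rightarrow>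
   ('v \<Rightarrow> 'h) \<Rightarrow> (complex \<Rightarrow> 'g::ab_group_add \<Rightarrow> 'g) \<Rightarrow> ('g \<Rightarrow> 'g \<Rightarrow> 'g) \<Rightarrow>
   ('h \<Rightarrow> 'g) \<Rightarrow> ('v \<Rightarrow> 'g) \<Rightarrow> ('v \<Rightarrow> 'g) \<Rightarrow> bool"
where
  "kac_moody_algebra B scaleH \<alpha> h scaleG br \<iota> e f \<longleftrightarrow>
     minimal_realization B scaleH \<alpha> h \<and>
     lie_presentation scaleG br (case_km_gen \<iota> e f) (chevalley_serre_relations B scaleH \<alpha> h)"

text \<open>
  Since the simple roots are linearly independent, an element \<open>\<Sum>\<^sub>i n\<^sub>i \<alpha>\<^sub>i\<close> of the positive
  root cone is identified with the multiset containing each \<open>i\<close> with multiplicity \<open>n\<^sub>i\<close>.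
\<close>

definition root_functional :: "('v \<Rightarrow> 'h \<Rightarrow> complex) \<Rightarrow> 'v multiset \<Rightarrow> 'h \<Rightarrow> complex" where
  "root_functional \<alpha> \<beta> x = (\<Sum>i\<in>#\<beta>. \<alpha> i x)"

definition root_space ::
  "(complex \<Rightarrow> 'g \<Rightarrow> 'g) \<Rightarrow> ('g \<Rightarrow> 'g \<Rightarrow> 'g) \<Rightarrow> ('h \<Rightarrow> 'g) \<Rightarrow> ('h \<Rightarrow> complex) \<Rightarrow> 'g set"
where
  "root_space scaleG br \<iota> \<phi> = {y. \<forall>x. br (\<iota> x) y = scaleG (\<phi> x) y}"

definition positive_roots ::
  "('v \<Rightarrow> 'h \<Rightarrow> complex) \<Rightarrow> (complex \<Rightarrow> 'g::ab_group_add \<Rightarrow> 'g) \<Rightarrow> ('g \<Rightarrow> 'g \<Rightarrow> 'g) \<Rightarrow>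
   ('h \<Rightarrow> 'g) \<Rightarrow> 'v multiset set"
where
  "positive_roots \<alpha> scaleG br \<iota> =
     {\<beta>. \<beta> \<noteq> {#} \<and> root_space scaleG br \<iota> (root_functional \<alpha> \<beta>) \<noteq> {0}}"

definition root_mult ::
  "('v \<Rightarrow> 'h \<Rightarrow> complex) \<Rightarrow> (complex \<Rightarrow> 'g::ab_group_add \<Rightarrow> 'g) \<Rightarrow> ('g \<Rightarrow> 'g \<Rightarrow> 'g) \<Rightarrow>
   ('h \<Rightarrow> 'g) \<Rightarrow> 'v multiset \<Rightarrow> nat"
where
  "root_mult \<alpha> scaleG br \<iota> \<beta> =
     vector_space.dim scaleG (root_space scaleG br \<iota> (root_functional \<alpha> \<beta>))"

text \<open>The coefficient ring is \<open>\<int>[q]\<close>, with \<open>q = [:0, 1:]\<close>.\<close>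

definition q_kostant ::
  "('v \<Rightarrow> 'h \<Rightarrow> complex) \<Rightarrow> (complex \<Rightarrow> 'g::ab_group_add \<Rightarrow> 'g) \<Rightarrow> ('g \<Rightarrow> 'g \<Rightarrow> 'g) \<Rightarrow>
   ('h \<Rightarrow> 'g) \<Rightarrow> 'v multiset \<Rightarrow> int poly"
where
  "q_kostant \<alpha> scaleG br \<iota> \<beta> =
     mfps_infprod_coeff
       (\<lambda>\<gamma>. inverse ((1 - mfps_monom [:0, 1:] \<gamma>) ^ root_mult \<alpha> scaleG br \<iota> \<gamma>))
       (positive_roots \<alpha> scaleG br \<iota>) \<beta>"

end

theory Submission
  imports Defs "HOL-Combinatorics.Multiset_Permutations"
begin

text \<open>
  Both sides are determined by the same recursion over subsets \<open>S\<close> of the vertices: for \<open>r\<close> in \<open>S\<close>,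
  the value at \<open>S\<close> is the sum over all \<open>B\<close> with \<open>r \<in> B \<subseteq> S\<close> of \<open>q \<cdot> u(B)\<close> times the value at
  \<open>S - B\<close>, where \<open>u(B)\<close> is the number of acyclic orientations of the induced subgraph on \<open>B\<close> whose
  only source is \<open>r\<close>. For the chromatic polynomial this is an alternating count of the colourings
  with prescribed colour of \<open>r\<close>. For the partition function it is the logarithmic derivative of the
  product, restricted to square-free exponents, together with \<open>mult \<beta>(B) = u(B)\<close>.

  The root space of \<open>\<beta>(B)\<close> is spanned by the nested brackets of the \<open>e\<^sub>i\<close>, \<open>i \<in> B\<close>, with \<open>e\<^sub>r\<close>
  innermost. As \<open>[e\<^sub>i, e\<^sub>j] = 0\<close> for nonadjacent vertices, such a bracket depends only on the
  orientation defined by the order of its letters, and it vanishes if there is a source other than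
  \<open>r\<close>. The remaining brackets are linearly independent: this is seen by letting \<open>g\<close> act on functions on
  words, with \<open>e\<^sub>i\<close> deleting an initial letter, where the indicator functions of the orientations
  separate them.
\<close>

section \<open>Words and acyclic orientations\<close>

text \<open>In an algebra given by generators and relations, rewriting bounds a root space from
  above, but a bound from below needs a representation that tells brackets apart and satisfies every
  relation, those among the f included. On arbitrary functions on words all relations hold except
  the Serre relations among the e, so one passes to the functions annihilated by these; that the f
  preserve this subspace is the computation where the Cartan entries 2, -1, 0 matter. Indicators of
  orientations lie in it for two reasons: they vanish on words with a repeated letter, and swapping
  neighbouring nonadjacent letters keeps the orientation.

  Only square-free exponents occur below \<beta>(\<Pi>), and for them the factor of a root \<gamma>
  can be replaced by 1 + q mult(\<gamma>) e^\<gamma>. The vertex \<open>r\<close> names one block in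
  each decomposition, so no logarithm or division is needed. The recursion for colourings carries
  the factor q (-1)^(|B|-1) = (-q) (-1)^|B|; this is the origin of both the argument -q and the sign
  (-1)^l. That the number of colourings is a polynomial in q is a by-product of the
  comparison.\<close>

text \<open>
  An acyclic orientation is represented by the set of its directed edges, and it is always given by
  a word listing the vertices: an edge points from the earlier to the later letter.
\<close>

primrec orient :: "('v \<Rightarrow> 'v \<Rightarrow> bool) \<Rightarrow> 'v list \<Rightarrow> ('v \<times> 'v) set" where
  "orient E [] = {}"
| "orient E (x # w) = {(x, y) | y. y \<in> set w \<and> E x y} \<union> orient E w"

lemma orient_subset: "orient E w \<subseteq> {(u, v). u \<in> set w \<and> v \<in> set w \<and> E u v}"
  by (induction w) auto

lemma orient_append:
  "orient E (v @ w) = orient E v \<union> {(x, y). x \<in> set v \<and> y \<in> set w \<and> E x y} \<union> orient E w"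
  by (induction v) auto

lemma orient_filter: "orient E (filter P w) = orient E w \<inter> {(u, v). P u \<and> P v}"
  using orient_subset[of E] by (induction w) auto

lemma orient_total:
  assumes "symp E" "E u v" "u \<noteq> v" "u \<in> set w" "v \<in> set w"
  shows "(u, v) \<in> orient E w \<or> (v, u) \<in> orient E w"
  using assms(4,5) by (induction w) (use assms in \<open>auto dest: sympD\<close>)

lemma orient_empty_iff:
  assumes "simple_graph E"
  shows "orient E w = {} \<longleftrightarrow> (\<forall>u\<in>set w. \<forall>v\<in>set w. \<not> E u v)"
  using orient_subset[of E w] orient_total[of E _ _ w] assms
  unfolding simple_graph_def by (fastforce simp: irreflp_def)

text \<open>An isolated vertex is a source too, so the edge leaving \<open>a\<close> is part of the
  claim. The first letter with a later neighbour works: no earlier letter has an edge to it.\<close>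

lemma orient_source_exists:
  assumes "orient E w \<noteq> {}" "distinct w"
  shows "\<exists>a b. (a, b) \<in> orient E w \<and> (\<forall>u. (u, a) \<notin> orient E w)"
  using assms
proof (induction w)
  case (Cons x w)
  show ?case
  proof (cases "\<exists>y\<in>set w. E x y")
    case True
    then obtain y where "y \<in> set w" "E x y" by blast
    moreover have "(u, x) \<notin> orient E (x # w)" for u
      using Cons.prems(2) orient_subset[of E w] by auto
    ultimately show ?thesis by (intro exI[of _ x] exI[of _ y]) auto
  next
    case False
    then have "{(x, y) | y. y \<in> set w \<and> E x y} = {}" by blast
    then have "orient E (x # w) = orient E w" by (simp only: orient.simps Un_empty_left)
    with Cons show ?thesis by (simp del: orient.simps)
  qed
qed simp

lemma orient_sink_exists:
  assumes "orient E w \<noteq> {}" "distinct w"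
  shows "\<exists>a b. (a, b) \<in> orient E w \<and> (\<forall>u. (b, u) \<notin> orient E w)"
  using assms
proof (induction w)
  case (Cons x w)
  show ?case
  proof (cases "orient E w = {}")
    case True
    then obtain y where y: "y \<in> set w" "E x y" using Cons.prems(1) by auto
    then have "x \<noteq> y" using Cons.prems(2) by auto
    with y True show ?thesis by (intro exI[of _ x] exI[of _ y]) auto
  next
    case False
    then obtain a b where ab: "(a, b) \<in> orient E w" "\<forall>u. (b, u) \<notin> orient E w"
      using Cons by auto
    then have "b \<in> set w" using orient_subset[of E w] by auto
    then have "b \<noteq> x" using Cons.prems(2) by auto
    with ab show ?thesis by (intro exI[of _ a] exI[of _ b]) auto
  qed
qed simp

section \<open>Sources, sinks and orientations with a single source\<close>

definition acyclic_orientations :: "('v \<Rightarrow> 'v \<Rightarrow> bool) \<Rightarrow> 'v set \<Rightarrow> ('v \<times> 'v) set set" where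
  "acyclic_orientations E S = orient E ` permutations_of_set S"

definition sources :: "'v set \<Rightarrow> ('v \<times> 'v) set \<Rightarrow> 'v set" where
  "sources S P = {v \<in> S. \<forall>u. (u, v) \<notin> P}"

definition sinks :: "'v set \<Rightarrow> ('v \<times> 'v) set \<Rightarrow> 'v set" where
  "sinks S P = {v \<in> S. \<forall>u. (v, u) \<notin> P}"

text \<open>The first letter of a word is always a source, so for nonempty \<open>S\<close> the
  inclusion amounts to equality.\<close>

definition rooted_orientations :: "('v \<Rightarrow> 'v \<Rightarrow> bool) \<Rightarrow> 'v set \<Rightarrow> 'v \<Rightarrow> ('v \<times> 'v) set set" where
  "rooted_orientations E S r = {P \<in> acyclic_orientations E S. sources S P \<subseteq> {r}}"

definition independent_set :: "('v \<Rightarrow> 'v \<Rightarrow> bool) \<Rightarrow> 'v set \<Rightarrow> bool" where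
  "independent_set E S \<longleftrightarrow> (\<forall>u\<in>S. \<forall>v\<in>S. \<not> E u v)"

lemma finite_acyclic_orientations [simp]: "finite (acyclic_orientations E S)"
  by (simp add: acyclic_orientations_def)

lemma finite_rooted_orientations [simp]: "finite (rooted_orientations E S r)"
  by (simp add: rooted_orientations_def)

text \<open>Toggling a fixed element of \<open>Y - X\<close> pairs the members of the interval with
  opposite signs.\<close>

lemma sum_minus_one_interval:
  assumes "finite Y"
  shows "(\<Sum>J | X \<subseteq> J \<and> J \<subseteq> Y. (- 1 :: int) ^ card J) = (if X = Y then (- 1) ^ card X else 0)"
proof (cases "X \<subset> Y")
  case True
  then obtain y where y: "y \<in> Y" "y \<notin> X" by blast
  let ?I = "{J. X \<subseteq> J \<and> J \<subseteq> Y}"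
  let ?K = "{J. X \<subseteq> J \<and> J \<subseteq> Y - {y}}"
  have fin: "finite ?K" by (rule finite_subset[of _ "Pow Y"]) (use assms in auto)
  have split: "?I = ?K \<union> insert y ` ?K"
  proof (rule subset_antisym; rule subsetI)
    fix J assume J: "J \<in> ?I"
    show "J \<in> ?K \<union> insert y ` ?K"
    proof (cases "y \<in> J")
      case True
      then have "J = insert y (J - {y})" by auto
      moreover have "J - {y} \<in> ?K" using J y by auto
      ultimately show ?thesis by blast
    qed (use J in auto)
  next
    fix J assume "J \<in> ?K \<union> insert y ` ?K"
    then show "J \<in> ?I" using y by blast
  qed
  have "(\<Sum>J\<in>?I. (- 1 :: int) ^ card J) =
      (\<Sum>J\<in>?K. (- 1) ^ card J) + (\<Sum>J\<in>insert y ` ?K. (- 1) ^ card J)"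
    unfolding split
  proof (rule sum.union_disjoint)
    show "?K \<inter> insert y ` ?K = {}" by blast
  qed (use fin in auto)
  also have "(\<Sum>J\<in>insert y ` ?K. (- 1 :: int) ^ card J) = (\<Sum>J\<in>?K. (- 1) ^ card (insert y J))"
    by (subst sum.reindex) (auto intro!: inj_onI)
  also have "\<dots> = (\<Sum>J\<in>?K. - ((- 1) ^ card J))"
  proof (rule sum.cong)
    fix J assume "J \<in> ?K"
    then have "finite J" "y \<notin> J" using assms finite_subset by auto
    then show "(- 1 :: int) ^ card (insert y J) = - ((- 1) ^ card J)" by simp
  qed simp
  finally show ?thesis using True by (simp add: sum_negf)
next
  case False
  show ?thesis
  proof (cases "X = Y")
    case True
    then have "{J. X \<subseteq> J \<and> J \<subseteq> Y} = {X}" by auto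
    with True show ?thesis by simp
  next
    case neq: False
    then have "{J. X \<subseteq> J \<and> J \<subseteq> Y} = {}" using False by auto
    with neq show ?thesis by (simp only: sum.empty if_False)
  qed
qed

text \<open>Writing the letters of \<open>J\<close> at the end of a word turns them into sinks. As
  \<open>J\<close> is independent, the only new edges run from \<open>T - J\<close> into
  \<open>J\<close>, so the extension is determined; the sources it can have besides \<open>r\<close>
  all lie in \<open>J\<close>.\<close>

lemma card_rooted_orientations_append:
  assumes E: "simple_graph E" and "finite T" "r \<in> T" and J: "J \<subseteq> T - {r}" "independent_set E J"
  shows "card (rooted_orientations E (T - J) r) =
    card {P \<in> acyclic_orientations E T. sources T P - {r} \<subseteq> J \<and> J \<subseteq> sinks T P - {r}}"
proof -
  let ?N = "{(u, v). u \<in> T - J \<and> v \<in> J \<and> E u v}"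
  let ?Q = "{P \<in> acyclic_orientations E T. sources T P - {r} \<subseteq> J \<and> J \<subseteq> sinks T P - {r}}"
  let ?R = "{(u, v). u \<notin> J \<and> v \<notin> J}"
  have symE: "symp E" and irr: "\<not> E v v" for v
    using E by (auto simp: simple_graph_def irreflp_def)
  have finJ: "finite J" using assms finite_subset by blast
  obtain js where js: "js \<in> permutations_of_set J"
    using finJ by (metis all_not_in_conv permutations_of_set_empty_iff)
  have js0: "orient E js = {}"
    using J(2) js by (simp add: orient_empty_iff[OF E] independent_set_def permutations_of_set_def)
  have "bij_betw (\<lambda>O'. O' \<union> ?N) (rooted_orientations E (T - J) r) ?Q"
  proof (rule bij_betw_byWitness[where f' = "\<lambda>P. P \<inter> ?R"])
    show "\<forall>O'\<in>rooted_orientations E (T - J) r. (O' \<union> ?N) \<inter> ?R = O'"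
    proof
      fix O' assume "O' \<in> rooted_orientations E (T - J) r"
      then obtain w where "set w = T - J" "O' = orient E w"
        by (auto simp: rooted_orientations_def acyclic_orientations_def permutations_of_set_def)
      then show "(O' \<union> ?N) \<inter> ?R = O'" using orient_subset[of E w] by auto
    qed
    have decomp: "(P \<inter> ?R) \<union> ?N = P" and edge_out: "\<And>u v. (u, v) \<in> P \<Longrightarrow> u \<notin> J"
      if "P \<in> ?Q" for P
    proof -
      obtain w where w: "set w = T" "P = orient E w" and Js: "J \<subseteq> sinks T P"
        using \<open>P \<in> ?Q\<close> by (auto simp: acyclic_orientations_def permutations_of_set_def)
      show out: "u \<notin> J" if "(u, v) \<in> P" for u v using Js that by (auto simp: sinks_def)
      \<comment> \<open>An edge between \<open>J\<close> and its complement must point into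
        \<open>J\<close>, so \<open>P\<close> is recovered from its restriction to the
        complement.\<close>
      have "(u, v) \<in> P" if "(u, v) \<in> ?N" for u v
      proof -
        have "E u v" "u \<in> T" "v \<in> T" "u \<noteq> v" using that J(1) by auto
        then have "(u, v) \<in> P \<or> (v, u) \<in> P" using orient_total[OF symE, of u v w] w by simp
        then show ?thesis using out that by blast
      qed
      then have "?N \<subseteq> P" by (auto simp only:)
      moreover have "(u, v) \<in> ?R \<or> (u, v) \<in> ?N" if uv: "(u, v) \<in> P" for u v
        using subsetD[OF orient_subset[of E w], of "(u, v)"] out[OF uv] uv w by simp
      ultimately show "(P \<inter> ?R) \<union> ?N = P" by blast
    qed
    then show "\<forall>P\<in>?Q. (P \<inter> ?R) \<union> ?N = P" by blast
    show "(\<lambda>O'. O' \<union> ?N) ` rooted_orientations E (T - J) r \<subseteq> ?Q"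
    proof
      fix P assume "P \<in> (\<lambda>O'. O' \<union> ?N) ` rooted_orientations E (T - J) r"
      then obtain w where w: "w \<in> permutations_of_set (T - J)" "P = orient E w \<union> ?N"
        and src: "sources (T - J) (orient E w) \<subseteq> {r}"
        by (auto simp: rooted_orientations_def acyclic_orientations_def)
      have setw: "set w = T - J" using w by (simp add: permutations_of_set_def)
      have "w @ js \<in> permutations_of_set T" "set js = J"
        using w js J(1) by (auto simp: permutations_of_set_def)
      moreover from this have "P = orient E (w @ js)"
        using w(2) setw js0 by (simp add: orient_append)
      ultimately have "P \<in> acyclic_orientations E T" by (auto simp: acyclic_orientations_def)
      moreover have "sources T P - {r} \<subseteq> J" using src w(2) by (auto simp: sources_def)
      moreover have "J \<subseteq> sinks T P - {r}"
        using J(1) w(2) setw orient_subset[of E w] by (auto simp: sinks_def)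
      ultimately show "P \<in> ?Q" by blast
    qed
    show "(\<lambda>P. P \<inter> ?R) ` ?Q \<subseteq> rooted_orientations E (T - J) r"
    proof
      fix O' assume "O' \<in> (\<lambda>P. P \<inter> ?R) ` ?Q"
      then obtain P where P: "P \<in> ?Q" and O': "O' = P \<inter> ?R" by blast
      then obtain w where w: "w \<in> permutations_of_set T" "P = orient E w"
        by (auto simp: acyclic_orientations_def)
      have "filter (\<lambda>v. v \<notin> J) w \<in> permutations_of_set (T - J)"
        using w by (auto simp: permutations_of_set_def)
      moreover have "O' = orient E (filter (\<lambda>v. v \<notin> J) w)"
        using O' w by (simp add: orient_filter)
      ultimately have "O' \<in> acyclic_orientations E (T - J)"
        by (auto simp: acyclic_orientations_def)
      moreover have "sources (T - J) O' \<subseteq> {r}"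
      proof
        fix v assume v: "v \<in> sources (T - J) O'"
        then have "v \<in> sources T P" using edge_out[OF P] by (auto simp: sources_def O')
        then show "v \<in> {r}" using P v by (auto simp: sources_def)
      qed
      ultimately show "O' \<in> rooted_orientations E (T - J) r"
        by (simp add: rooted_orientations_def)
    qed
  qed
  then show ?thesis by (rule bij_betw_same_card)
qed

text \<open>If there is an edge, some source emits one and is no sink, and some sink receives one
  and is no source. Agreement away from \<open>r\<close> forces both vertices to be
  \<open>r\<close>, which would then be a source and not a source.\<close>

lemma sources_sinks_eq_imp_empty:
  assumes "P \<in> acyclic_orientations E T" "sources T P - {r} = sinks T P - {r}"
  shows "P = {}"
proof (rule ccontr)
  assume ne: "P \<noteq> {}"
  obtain w where w: "set w = T" "distinct w" "P = orient E w"
    using assms(1) by (auto simp: acyclic_orientations_def permutations_of_set_def)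
  obtain a b where ab: "(a, b) \<in> P" "a \<in> sources T P" "a \<notin> sinks T P"
    using orient_source_exists[of E w] ne w orient_subset[of E w]
    by (auto simp: sources_def sinks_def)
  obtain c d where cd: "(c, d) \<in> P" "d \<in> sinks T P" "d \<notin> sources T P"
    using orient_sink_exists[of E w] ne w orient_subset[of E w]
    by (auto simp: sources_def sinks_def)
  have "a = r" "d = r" using ab cd assms(2) by blast+
  with ab cd show False by (auto simp: sources_def)
qed

text \<open>
  Adding the sinks \<open>J\<close> back gives a signed sum over orientations \<open>P\<close> of all of \<open>T\<close>, in which \<open>J\<close>
  ranges over the interval between the sources and the sinks of \<open>P\<close> other than \<open>r\<close>.
\<close>

theorem sum_rooted_orientations:
  assumes E: "simple_graph E" and T: "finite T" "r \<in> T"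
  shows "(\<Sum>J | J \<subseteq> T - {r} \<and> independent_set E J.
      (- 1 :: int) ^ (card (T - J) - 1) * int (card (rooted_orientations E (T - J) r))) =
    (if independent_set E T then 1 else 0)" (is "?lhs = _")
proof -
  have symE: "symp E" and irr: "\<not> E v v" for v
    using E by (auto simp: simple_graph_def irreflp_def)
  let ?A = "acyclic_orientations E T"
  let ?n = "card T - 1"
  let ?in = "\<lambda>P J. sources T P - {r} \<subseteq> J \<and> J \<subseteq> sinks T P - {r}"
  have finPow: "finite (Pow (T - {r}))" using T by simp
  have indep: "independent_set E J" if P: "P \<in> ?A" "J \<subseteq> sinks T P" for P J
  proof -
    obtain w where w: "set w = T" "P = orient E w"
      using P by (auto simp: acyclic_orientations_def permutations_of_set_def)
    have "\<not> E u v" if "u \<in> J" "v \<in> J" for u v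
      using orient_total[OF symE, of u v w] that P(2) w irr[of u] by (auto simp: sinks_def)
    then show ?thesis by (auto simp: independent_set_def)
  qed
  have sign: "(- 1 :: int) ^ (card (T - J) - 1) = (- 1) ^ ?n * (- 1) ^ card J"
    if "J \<subseteq> T - {r}" for J
  proof -
    have "finite J" using T that finite_subset by blast
    then have "card (T - J) = card T - card J" using that by (intro card_Diff_subset) auto
    moreover have "card J \<le> ?n"
      using card_mono[of "T - {r}" J] that T by simp
    moreover have "card T > 0" using T card_gt_0_iff by blast
    \<comment> \<open>Exact despite the truncated subtraction, because \<open>r\<close> belongs to
      \<open>T\<close> but not to \<open>J\<close>.\<close>
    ultimately have *: "?n = card (T - J) - 1 + card J" by linarith
    have "(- 1 :: int) ^ ?n * (- 1) ^ card J = (- 1) ^ (card (T - J) - 1) * ((- 1) ^ card J * (- 1) ^ card J)"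
      unfolding * power_add by simp
    then show ?thesis by (simp flip: power_mult_distrib)
  qed
  have "?lhs = (\<Sum>J | J \<subseteq> T - {r} \<and> independent_set E J.
      (- 1) ^ ?n * (- 1) ^ card J * (\<Sum>P\<in>?A. if ?in P J then 1 else 0))"
  proof (rule sum.cong)
    fix J assume "J \<in> {J. J \<subseteq> T - {r} \<and> independent_set E J}"
    then have J: "J \<subseteq> T - {r}" "independent_set E J" by auto
    have "(\<Sum>P\<in>?A. if ?in P J then 1 else 0) = int (card {P \<in> ?A. ?in P J})"
      by (simp add: sum.If_cases Int_def)
    then show "(- 1) ^ (card (T - J) - 1) * int (card (rooted_orientations E (T - J) r)) =
        (- 1) ^ ?n * (- 1) ^ card J * (\<Sum>P\<in>?A. if ?in P J then 1 else 0)"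
      using card_rooted_orientations_append[OF E T J] sign[OF J(1)] by simp
  qed simp
  also have "\<dots> = (\<Sum>P\<in>?A. \<Sum>J | J \<subseteq> T - {r} \<and> independent_set E J.
      if ?in P J then (- 1) ^ ?n * (- 1) ^ card J else 0)"
    unfolding sum_distrib_left by (subst sum.swap) (simp add: if_distrib cong: if_cong)
  \<comment> \<open>Sinks are pairwise nonadjacent, so lying in \<open>sinks T P - {r}\<close>
    already makes \<open>J\<close> an independent subset of \<open>T - {r}\<close>.\<close>
  also have "\<dots> = (\<Sum>P\<in>?A. \<Sum>J | ?in P J. (- 1) ^ ?n * (- 1) ^ card J)"
  proof (rule sum.cong)
    fix P assume P: "P \<in> ?A"
    have "{J. ?in P J} = {J. J \<subseteq> T - {r} \<and> independent_set E J} \<inter> {J. ?in P J}"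
      using indep[OF P] by (auto simp: sinks_def)
    moreover have "finite {J. J \<subseteq> T - {r} \<and> independent_set E J}"
      by (rule finite_subset[OF _ finPow]) auto
    note sum.inter_restrict[OF this, of "\<lambda>J. (- 1 :: int) ^ ?n * (- 1) ^ card J" "{J. ?in P J}"]
    ultimately show "(\<Sum>J | J \<subseteq> T - {r} \<and> independent_set E J.
        if ?in P J then (- 1) ^ ?n * (- 1) ^ card J else 0) =
      (\<Sum>J | ?in P J. (- 1 :: int) ^ ?n * (- 1) ^ card J)"
      by (simp only: mem_Collect_eq)
  qed simp
  also have "\<dots> = (\<Sum>P\<in>?A. if sources T P - {r} = sinks T P - {r}
      then (- 1) ^ ?n * (- 1) ^ card (sources T P - {r}) else 0)"
  proof (rule sum.cong)
    fix P
    have "finite (sinks T P - {r})" using T by (auto simp: sinks_def)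
    then show "(\<Sum>J | ?in P J. (- 1 :: int) ^ ?n * (- 1) ^ card J) =
      (if sources T P - {r} = sinks T P - {r} then (- 1) ^ ?n * (- 1) ^ card (sources T P - {r}) else 0)"
      unfolding sum_distrib_left[symmetric] by (simp add: sum_minus_one_interval)
  qed simp
  \<comment> \<open>Only the empty orientation survives. All of \<open>T\<close> are its sources, so
    both signs have exponent \<open>card T - 1\<close> and their product is 1.\<close>
  also have "\<dots> = (\<Sum>P\<in>?A. if P = {} then 1 else 0)"
  proof (rule sum.cong)
    fix P assume P: "P \<in> ?A"
    have "sources T {} = T" "sinks T {} = T" by (auto simp: sources_def sinks_def)
    then show "(if sources T P - {r} = sinks T P - {r}
        then (- 1 :: int) ^ ?n * (- 1) ^ card (sources T P - {r}) else 0) = (if P = {} then 1 else 0)"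
      using sources_sinks_eq_imp_empty[OF P, of r] T by (simp flip: power_mult_distrib)
  qed simp
  also have "\<dots> = (if {} \<in> ?A then 1 else 0)" by simp
  also have "{} \<in> ?A \<longleftrightarrow> independent_set E T"
  proof -
    obtain w where w: "w \<in> permutations_of_set T"
      using T by (metis all_not_in_conv permutations_of_set_empty_iff)
    show ?thesis
    proof
      assume "{} \<in> ?A"
      then obtain w where "set w = T" "orient E w = {}"
        by (auto simp: acyclic_orientations_def permutations_of_set_def)
      then show "independent_set E T"
        using orient_empty_iff[OF E, of w] by (simp add: independent_set_def)
    next
      assume "independent_set E T"
      then have "orient E w = {}"
        using w orient_empty_iff[OF E, of w] by (simp add: independent_set_def permutations_of_set_def)
      then show "{} \<in> ?A" using w unfolding acyclic_orientations_def by (metis imageI)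
    qed
  qed
  finally show ?thesis .
qed

section \<open>Counting colourings\<close>

definition num_colorings :: "('v \<Rightarrow> 'v \<Rightarrow> bool) \<Rightarrow> 'c set \<Rightarrow> 'v set \<Rightarrow> nat" where
  "num_colorings E C S = card {f \<in> S \<rightarrow>\<^sub>E C. \<forall>u\<in>S. \<forall>v\<in>S. E u v \<longrightarrow> f u \<noteq> f v}"

lemma num_colorings_empty [simp]: "num_colorings E C {} = 1"
  by (simp add: num_colorings_def PiE_empty_domain)

lemma card_proper_colorings:
  "card (proper_colorings E q) = num_colorings E {..<q} (UNIV :: 'v::finite set)"
  unfolding proper_colorings_def num_colorings_def
  by (rule arg_cong[of _ _ card]) (auto simp: PiE_def extensional_def)

lemma card_colorings_class:
  assumes E: "simple_graph E" and c: "c \<in> C" and J: "J \<subseteq> S" "independent_set E J"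
  shows "card {f \<in> S \<rightarrow>\<^sub>E C. (\<forall>u\<in>S. \<forall>v\<in>S. E u v \<longrightarrow> f u \<noteq> f v) \<and> {v \<in> S. f v = c} = J} =
    num_colorings E (C - {c}) (S - J)" (is "card ?A = _")
proof -
  let ?B = "{f \<in> (S - J) \<rightarrow>\<^sub>E (C - {c}). \<forall>u\<in>S - J. \<forall>v\<in>S - J. E u v \<longrightarrow> f u \<noteq> f v}"
  have "bij_betw (\<lambda>f. restrict f (S - J)) ?A ?B"
  proof (rule bij_betw_byWitness[where f' = "\<lambda>g v. if v \<in> J then c else g v"])
    show "\<forall>f\<in>?A. (\<lambda>v. if v \<in> J then c else restrict f (S - J) v) = f"
      by (auto simp: fun_eq_iff restrict_def PiE_def extensional_def)
    show "\<forall>g\<in>?B. restrict (\<lambda>v. if v \<in> J then c else g v) (S - J) = g"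
      using J by (auto simp: fun_eq_iff restrict_def PiE_def extensional_def)
    show "(\<lambda>f. restrict f (S - J)) ` ?A \<subseteq> ?B"
    proof (intro subsetI, elim imageE)
      fix g f assume f: "f \<in> ?A" and g: "g = restrict f (S - J)"
      have "f v \<in> C - {c}" if "v \<in> S - J" for v using f that by auto
      then show "g \<in> ?B" using f by (auto simp: g)
    qed
    show "(\<lambda>g v. if v \<in> J then c else g v) ` ?B \<subseteq> ?A"
    proof (intro subsetI, elim imageE)
      fix f g assume g: "g \<in> ?B" and f: "f = (\<lambda>v. if v \<in> J then c else g v)"
      have gv: "g v \<in> C" "g v \<noteq> c" if "v \<in> S - J" for v using g that by auto
      have "f \<in> S \<rightarrow>\<^sub>E C" using g c J(1) gv by (auto simp: f PiE_def extensional_def)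
      moreover have "{v \<in> S. f v = c} = J" using J(1) gv by (auto simp: f)
      moreover have "f u \<noteq> f v" if "u \<in> S" "v \<in> S" "E u v" for u v
      proof -
        have "u \<notin> J \<or> v \<notin> J" using J(2) that by (auto simp: independent_set_def)
        then show ?thesis using g gv(2)[of u] gv(2)[of v] that by (auto simp: f)
      qed
      ultimately show "f \<in> ?A" by blast
    qed
  qed
  then show ?thesis unfolding num_colorings_def by (rule bij_betw_same_card)
qed

text \<open>The predicate \<open>P\<close> serves two uses: constantly true it expands the number of
  all colourings, and as membership of \<open>r\<close> it fixes the colour of
  \<open>r\<close>.\<close>

lemma card_colorings_by_class:
  assumes E: "simple_graph E" and fin: "finite C" "finite S" and c: "c \<in> C"
  shows "card {f \<in> S \<rightarrow>\<^sub>E C. (\<forall>u\<in>S. \<forall>v\<in>S. E u v \<longrightarrow> f u \<noteq> f v) \<and> P {v \<in> S. f v = c}} =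
    (\<Sum>J | J \<subseteq> S \<and> independent_set E J \<and> P J. num_colorings E (C - {c}) (S - J))"
    (is "card ?A = sum _ ?I")
proof -
  have finI: "finite ?I" by (rule finite_subset[of _ "Pow S"]) (use fin in auto)
  have finA: "finite ?A" by (rule finite_subset[OF _ finite_PiE[of S "\<lambda>_. C"]]) (use fin in auto)
  have "(\<lambda>f. {v \<in> S. f v = c}) \<in> ?A \<rightarrow> ?I"
    by (auto simp: independent_set_def) (metis (mono_tags, lifting))
  then have "card ?A = (\<Sum>J\<in>?I. card {f \<in> ?A. {v \<in> S. f v = c} = J})"
    using card_eq_sum sum.group[OF finA finI, of "\<lambda>f. {v \<in> S. f v = c}" "\<lambda>_. 1 :: nat"]
    by (simp add: image_subset_iff_funcset)
  also have "\<dots> = (\<Sum>J\<in>?I. num_colorings E (C - {c}) (S - J))"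
  proof (rule sum.cong)
    fix J assume J: "J \<in> ?I"
    then have "{f \<in> ?A. {v \<in> S. f v = c} = J} =
      {f \<in> S \<rightarrow>\<^sub>E C. (\<forall>u\<in>S. \<forall>v\<in>S. E u v \<longrightarrow> f u \<noteq> f v) \<and> {v \<in> S. f v = c} = J}" by blast
    then show "card {f \<in> ?A. {v \<in> S. f v = c} = J} = num_colorings E (C - {c}) (S - J)"
      using card_colorings_class[OF E c, of J S] J by simp
  qed simp
  finally show ?thesis .
qed

text \<open>
  Expanding \<open>num_colorings E C (S - B)\<close> by the colour class of \<open>c\<close> and collecting the terms with
  the same union of \<open>B\<close> and this class, all non-independent unions cancel.
\<close>

lemma num_colorings_fixed:
  assumes E: "simple_graph E" and fin: "finite C" "finite S" and c: "c \<in> C" and r: "r \<in> S"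
  shows "int (card {f \<in> S \<rightarrow>\<^sub>E C. (\<forall>u\<in>S. \<forall>v\<in>S. E u v \<longrightarrow> f u \<noteq> f v) \<and> f r = c}) =
    (\<Sum>B | r \<in> B \<and> B \<subseteq> S.
      (- 1) ^ (card B - 1) * int (card (rooted_orientations E B r)) * int (num_colorings E C (S - B)))"
    (is "int (card ?A) = ?rhs")
proof -
  let ?F = "\<lambda>X. int (num_colorings E (C - {c}) X)"
  let ?m = "\<lambda>B. (- 1) ^ (card B - 1) * int (card (rooted_orientations E B r))"
  have finP: "finite {B. B \<subseteq> S \<and> Q B}" for Q by (rule finite_subset[of _ "Pow S"]) (use fin in auto)
  have finP': "finite {B. r \<in> B \<and> B \<subseteq> S}" by (rule finite_subset[of _ "Pow S"]) (use fin in auto)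
  have Un_Diff': "B \<union> J - J = B" if "J \<subseteq> S - B" for B J using that by blast
  have A: "?A = {f \<in> S \<rightarrow>\<^sub>E C. (\<forall>u\<in>S. \<forall>v\<in>S. E u v \<longrightarrow> f u \<noteq> f v) \<and> r \<in> {v \<in> S. f v = c}}"
    using r by auto
  have "?rhs = (\<Sum>B | r \<in> B \<and> B \<subseteq> S. ?m B *
      (\<Sum>J | J \<subseteq> S - B \<and> independent_set E J. ?F (S - B - J)))"
  proof (rule sum.cong)
    fix B assume "B \<in> {B. r \<in> B \<and> B \<subseteq> S}"
    show "?m B * int (num_colorings E C (S - B)) =
      ?m B * (\<Sum>J | J \<subseteq> S - B \<and> independent_set E J. ?F (S - B - J))"
      using card_colorings_by_class[OF E fin(1) _ c, of "S - B" "\<lambda>_. True"] fin(2)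
      by (simp add: num_colorings_def)
  qed simp
  also have "\<dots> = (\<Sum>(B, J)\<in>(SIGMA B:{B. r \<in> B \<and> B \<subseteq> S}. {J. J \<subseteq> S - B \<and> independent_set E J}).
      ?m B * ?F (S - B - J))"
    unfolding sum_distrib_left by (rule sum.Sigma) (use finP' fin in auto)
  also have "\<dots> = (\<Sum>(T, J)\<in>(SIGMA T:{T. r \<in> T \<and> T \<subseteq> S}. {J. J \<subseteq> T - {r} \<and> independent_set E J}).
      ?m (T - J) * ?F (S - T))"
    by (rule sum.reindex_bij_witness[of _ "\<lambda>(T, J). (T - J, J)" "\<lambda>(B, J). (B \<union> J, J)"])
       (auto simp: Un_Diff' intro!: arg_cong2[of _ _ _ _ "(*)"] arg_cong[of _ _ ?F])
  also have "\<dots> = (\<Sum>T | r \<in> T \<and> T \<subseteq> S. \<Sum>J | J \<subseteq> T - {r} \<and> independent_set E J. ?m (T - J) * ?F (S - T))"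
  proof (rule sum.Sigma[symmetric, OF finP'], intro ballI)
    fix T assume "T \<in> {T. r \<in> T \<and> T \<subseteq> S}"
    then show "finite {J. J \<subseteq> T - {r} \<and> independent_set E J}"
      using finite_subset[of "{J. J \<subseteq> T - {r} \<and> independent_set E J}" "Pow S"] fin by auto
  qed
  also have "\<dots> = (\<Sum>T | r \<in> T \<and> T \<subseteq> S. if independent_set E T then ?F (S - T) else 0)"
  proof (rule sum.cong)
    fix T assume "T \<in> {T. r \<in> T \<and> T \<subseteq> S}"
    then have T: "r \<in> T" "finite T" using fin finite_subset by auto
    show "(\<Sum>J | J \<subseteq> T - {r} \<and> independent_set E J. ?m (T - J) * ?F (S - T)) =
      (if independent_set E T then ?F (S - T) else 0)"
      unfolding sum_distrib_right[symmetric] sum_rooted_orientations[OF E T(2,1)] by simp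
  qed simp
  also have "\<dots> = (\<Sum>T | T \<subseteq> S \<and> independent_set E T \<and> r \<in> T. ?F (S - T))"
  proof -
    have "{T. T \<subseteq> S \<and> independent_set E T \<and> r \<in> T} = {T. r \<in> T \<and> T \<subseteq> S} \<inter> {T. independent_set E T}"
      by auto
    then show ?thesis by (simp only: sum.inter_restrict[OF finP'] mem_Collect_eq)
  qed
  also have "\<dots> = int (card ?A)"
    unfolding A card_colorings_by_class[OF E fin c, of "\<lambda>J. r \<in> J"] by simp
  finally show ?thesis by simp
qed

text \<open>The right hand side of \<open>num_colorings_fixed\<close> does not mention the colour
  \<open>c\<close>. Hence every colour of \<open>r\<close> contributes the same amount, which gives
  the factor \<open>card C\<close>.\<close>

theorem num_colorings_rec:
  assumes E: "simple_graph E" and fin: "finite C" "finite S" and r: "r \<in> S"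
  shows "int (num_colorings E C S) = int (card C) * (\<Sum>B | r \<in> B \<and> B \<subseteq> S.
      (- 1) ^ (card B - 1) * int (card (rooted_orientations E B r)) * int (num_colorings E C (S - B)))"
proof -
  let ?A = "{f \<in> S \<rightarrow>\<^sub>E C. \<forall>u\<in>S. \<forall>v\<in>S. E u v \<longrightarrow> f u \<noteq> f v}"
  have finA: "finite ?A" by (rule finite_subset[OF _ finite_PiE[of S "\<lambda>_. C"]]) (use fin in auto)
  have "(\<lambda>f. f r) ` ?A \<subseteq> C" using r by auto
  then have "card ?A = (\<Sum>c\<in>C. card {f \<in> ?A. f r = c})"
    using sum.group[OF finA fin(1), of "\<lambda>f. f r" "\<lambda>_. 1 :: nat"] by simp
  then have "int (num_colorings E C S) = (\<Sum>c\<in>C. int (card {f \<in> ?A. f r = c}))"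
    by (simp add: num_colorings_def)
  also have "\<dots> = (\<Sum>c\<in>C. \<Sum>B | r \<in> B \<and> B \<subseteq> S.
      (- 1) ^ (card B - 1) * int (card (rooted_orientations E B r)) * int (num_colorings E C (S - B)))"
    by (rule sum.cong) (simp_all only: mem_Collect_eq conj_assoc num_colorings_fixed[OF E fin _ r])
  finally show ?thesis by simp
qed

section \<open>Square-free coefficients of power series\<close>

lemma mfps_coeff_one: "mfps_coeff 1 \<beta> = (if \<beta> = {#} then 1 else 0)"
  and mfps_coeff_diff [simp]: "mfps_coeff (f - g) \<beta> = mfps_coeff f \<beta> - mfps_coeff g \<beta>"
  by (transfer; simp)+

lemma mfps_coeff_mult:
  "mfps_coeff (f * g) \<beta> = (\<Sum>(\<gamma>, \<delta>) \<in> {(\<gamma>, \<delta>). \<gamma> + \<delta> = \<beta>}. mfps_coeff f \<gamma> * mfps_coeff g \<delta>)"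
  by transfer simp

lemma mfps_coeff_monom [simp]: "mfps_coeff (mfps_monom c \<alpha>) \<beta> = (if \<beta> = \<alpha> then c else 0)"
  by (simp add: mfps_monom_def)

lemma mfps_coeff_monom_mult:
  fixes c :: "'c::comm_ring_1"
  shows "mfps_coeff (mfps_monom c \<alpha> * g) \<beta> = (if \<alpha> \<subseteq># \<beta> then c * mfps_coeff g (\<beta> - \<alpha>) else 0)"
proof -
  have "mfps_coeff (mfps_monom c \<alpha> * g) \<beta> =
    (\<Sum>(\<gamma>, \<delta>) \<in> {(\<gamma>, \<delta>). \<gamma> + \<delta> = \<beta>}. (if \<gamma> = \<alpha> then c else 0) * mfps_coeff g \<delta>)"
    by (simp add: mfps_coeff_mult)
  also have "\<dots> = (\<Sum>(\<gamma>, \<delta>) \<in> (if \<alpha> \<subseteq># \<beta> then {(\<alpha>, \<beta> - \<alpha>)} else {}).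
      (if \<gamma> = \<alpha> then c else 0) * mfps_coeff g \<delta>)"
    by (rule sum.mono_neutral_right[OF finite_mset_summands])
       (auto split: if_splits)
  also have "\<dots> = (if \<alpha> \<subseteq># \<beta> then c * mfps_coeff g (\<beta> - \<alpha>) else 0)" by auto
  finally show ?thesis .
qed

section \<open>Geometric series as inverses\<close>

lemma mfps_inverse_unique:
  fixes f g :: "('v, 'c::comm_ring_1) mfps"
  assumes "f * g = 1"
  shows "inverse f = g"
proof -
  have "g' = g" if "f * g' = 1" for g'
  proof -
    have "g' = (f * g) * g'" by (simp add: assms)
    also have "\<dots> = (f * g') * g" by (simp only: mult.assoc mult.commute[of g g'])
    finally show ?thesis by (simp add: that)
  qed
  then have "(THE g. f * g = 1) = g" using assms by blast
  with assms show ?thesis unfolding inverse_mfps_def by auto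
qed

text \<open>The series with terms c^k e^(k \<gamma>). The description of \<open>k\<close> is
  meaningful only for nonempty \<gamma>, since every multiple of \<open>{#}\<close> is
  \<open>{#}\<close>.\<close>

definition mfps_geometric :: "'c::comm_ring_1 \<Rightarrow> 'v multiset \<Rightarrow> ('v, 'c) mfps" where
  "mfps_geometric c \<gamma> =
    Abs_mfps (\<lambda>\<beta>. if \<exists>k. \<beta> = repeat_mset k \<gamma> then c ^ (THE k. \<beta> = repeat_mset k \<gamma>) else 0)"

lemma repeat_mset_inj:
  assumes "\<gamma> \<noteq> {#}" "repeat_mset k \<gamma> = repeat_mset l \<gamma>"
  shows "k = l"
proof -
  obtain x where "x \<in># \<gamma>" using assms(1) by blast
  moreover have "k * count \<gamma> x = l * count \<gamma> x"
    using arg_cong[OF assms(2), of "\<lambda>M. count M x"] by simp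
  ultimately show ?thesis by (metis count_greater_zero_iff mult_cancel2 neq0_conv)
qed

lemma mfps_coeff_geometric_repeat:
  assumes "\<gamma> \<noteq> {#}"
  shows "mfps_coeff (mfps_geometric c \<gamma>) (repeat_mset k \<gamma>) = c ^ k"
proof -
  have "(THE l. repeat_mset k \<gamma> = repeat_mset l \<gamma>) = k"
    using repeat_mset_inj[OF assms] by blast
  then show ?thesis by (auto simp: mfps_geometric_def)
qed

lemma mfps_coeff_geometric_other:
  "(\<And>k. \<beta> \<noteq> repeat_mset k \<gamma>) \<Longrightarrow> mfps_coeff (mfps_geometric c \<gamma>) \<beta> = 0"
  by (simp add: mfps_geometric_def)

lemma mfps_geometric_inverse:
  fixes c :: "'c::comm_ring_1"
  assumes \<gamma>: "\<gamma> \<noteq> {#}"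
  shows "(1 - mfps_monom c \<gamma>) * mfps_geometric c \<gamma> = 1"
proof (rule mfps_eqI)
  fix \<beta> :: "'a multiset"
  let ?g = "mfps_geometric c \<gamma>"
  have eq: "mfps_coeff ((1 - mfps_monom c \<gamma>) * ?g) \<beta> =
      mfps_coeff ?g \<beta> - (if \<gamma> \<subseteq># \<beta> then c * mfps_coeff ?g (\<beta> - \<gamma>) else 0)"
    by (simp add: left_diff_distrib mfps_coeff_monom_mult)
  show "mfps_coeff ((1 - mfps_monom c \<gamma>) * ?g) \<beta> = mfps_coeff 1 \<beta>"
  proof (cases "\<exists>k. \<beta> = repeat_mset k \<gamma>")
    case True
    then obtain k where k: "\<beta> = repeat_mset k \<gamma>" by blast
    show ?thesis
    proof (cases k)
      case 0
      then have "\<beta> = {#}" using k by simp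
      moreover have "mfps_coeff ?g {#} = 1" using mfps_coeff_geometric_repeat[OF \<gamma>, of c 0] by simp
      ultimately show ?thesis using \<gamma> unfolding eq by (simp add: mfps_coeff_one)
    next
      case (Suc l)
      then have "\<beta> = \<gamma> + repeat_mset l \<gamma>" using k by simp
      then have "\<gamma> \<subseteq># \<beta>" "\<beta> - \<gamma> = repeat_mset l \<gamma>" "\<beta> \<noteq> {#}" using \<gamma> by auto
      then show ?thesis unfolding eq
        using mfps_coeff_geometric_repeat[OF \<gamma>, of c l] mfps_coeff_geometric_repeat[OF \<gamma>, of c k] k Suc
        by (simp add: mfps_coeff_one del: repeat_mset_Suc)
    qed
  next
    case False
    then have "\<beta> \<noteq> {#}" using spec[OF False[unfolded not_ex], of 0] by simp
    moreover have "mfps_coeff ?g (\<beta> - \<gamma>) = 0" if "\<gamma> \<subseteq># \<beta>"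
    proof (rule mfps_coeff_geometric_other)
      fix k
      show "\<beta> - \<gamma> \<noteq> repeat_mset k \<gamma>"
      proof
        assume "\<beta> - \<gamma> = repeat_mset k \<gamma>"
        then have "\<gamma> + (\<beta> - \<gamma>) = repeat_mset (Suc k) \<gamma>" by simp
        then have "\<beta> = repeat_mset (Suc k) \<gamma>" using that by (simp only: subset_mset.add_diff_inverse)
        with False show False by blast
      qed
    qed
    ultimately show ?thesis using False unfolding eq by (simp add: mfps_coeff_one mfps_coeff_geometric_other)
  qed
qed

section \<open>Coefficients at square-free exponents\<close>

lemma mset_set_Diff_add:
  assumes "finite S" "A \<subseteq> S"
  shows "mset_set A + mset_set (S - A) = mset_set S"
proof -
  have "mset_set (A \<union> (S - A)) = mset_set A + mset_set (S - A)"
    by (rule mset_set_Union) (use assms finite_subset[OF assms(2,1)] in auto)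
  moreover have "A \<union> (S - A) = S" using assms by auto
  ultimately show ?thesis by simp
qed

lemma mset_set_eq_plus:
  assumes "finite S" "\<gamma> + \<delta> = mset_set S"
  shows "\<gamma> = mset_set (set_mset \<gamma>)" "\<delta> = mset_set (S - set_mset \<gamma>)" "set_mset \<gamma> \<subseteq> S"
proof -
  have le: "count \<gamma> x + count \<delta> x = (if x \<in> S then 1 else 0)" for x
    using arg_cong[OF assms(2), of "\<lambda>M. count M x"] assms(1) by (auto split: if_splits)
  show sub: "set_mset \<gamma> \<subseteq> S" 
    using assms by (metis finite_set_mset_mset_set mset_subset_eq_add_left set_mset_mono)
  show 1: "\<gamma> = mset_set (set_mset \<gamma>)"
  proof (rule multiset_eqI)
    fix x show "count \<gamma> x = count (mset_set (set_mset \<gamma>)) x"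
    proof (cases "x \<in># \<gamma>")
      case True
      then have "count \<gamma> x \<ge> 1" by (simp add: Suc_le_eq)
      moreover have "count \<gamma> x \<le> 1" using le[of x] by (simp split: if_splits)
      ultimately have "count \<gamma> x = 1" by linarith
      with True show ?thesis by simp
    next
      case False
      then show ?thesis by (simp add: not_in_iff)
    qed
  qed
  show "\<delta> = mset_set (S - set_mset \<gamma>)"
    using assms(2) mset_set_Diff_add[OF assms(1) sub] 1 by (metis add_left_imp_eq)
qed

text \<open>Summands of a square-free multiset are square-free, so its decompositions are the
  splittings of \<open>S\<close> into a subset and its complement. Square-free coefficients
  therefore multiply among themselves.\<close>

lemma mfps_coeff_mult_mset_set:
  assumes S: "finite S"
  shows "mfps_coeff (f * g) (mset_set S) =
    (\<Sum>A | A \<subseteq> S. mfps_coeff f (mset_set A) * mfps_coeff g (mset_set (S - A)))"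
  unfolding mfps_coeff_mult
proof (rule sum.reindex_bij_witness[of _ "\<lambda>A. (mset_set A, mset_set (S - A))" "\<lambda>(\<gamma>, \<delta>). set_mset \<gamma>"])
  fix A assume "A \<in> {A. A \<subseteq> S}"
  then show "(\<lambda>(\<gamma>, \<delta>). set_mset \<gamma>) (mset_set A, mset_set (S - A)) = A"
    "(mset_set A, mset_set (S - A)) \<in> {(\<gamma>, \<delta>). \<gamma> + \<delta> = mset_set S}"
    using S finite_subset[of A S] by (simp_all add: mset_set_Diff_add)
next
  fix p assume p: "p \<in> {(\<gamma>, \<delta>). \<gamma> + \<delta> = mset_set S}"
  obtain \<gamma> \<delta> where "p = (\<gamma>, \<delta>)" by force
  with p mset_set_eq_plus[OF S, of \<gamma> \<delta>]
  show "(mset_set ((\<lambda>(\<gamma>, \<delta>). set_mset \<gamma>) p), mset_set (S - (\<lambda>(\<gamma>, \<delta>). set_mset \<gamma>) p)) = p"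
    "(\<lambda>(\<gamma>, \<delta>). set_mset \<gamma>) p \<in> {A. A \<subseteq> S}"
    "mfps_coeff f (mset_set ((\<lambda>(\<gamma>, \<delta>). set_mset \<gamma>) p)) *
      mfps_coeff g (mset_set (S - (\<lambda>(\<gamma>, \<delta>). set_mset \<gamma>) p)) =
      (case p of (\<gamma>, \<delta>) \<Rightarrow> mfps_coeff f \<gamma> * mfps_coeff g \<delta>)"
    by auto
qed

lemma mset_set_eq_iff: "finite A \<Longrightarrow> finite B \<Longrightarrow> mset_set A = mset_set B \<longleftrightarrow> A = B"
  by (metis finite_set_mset_mset_set)

text \<open>A multiple k \<gamma> with k at least 2 is never square-free, so only the terms for k =
  0 and k = 1 are visible.\<close>

lemma mfps_coeff_geometric_mset_set:
  assumes \<gamma>: "\<gamma> \<noteq> {#}" and S: "finite S"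
  shows "mfps_coeff (mfps_geometric c \<gamma>) (mset_set S) =
    (if S = {} then 1 else if mset_set S = \<gamma> then c else 0)"
proof (cases "\<exists>k. mset_set S = repeat_mset k \<gamma>")
  case True
  then obtain k where k: "mset_set S = repeat_mset k \<gamma>" by blast
  obtain x where x: "x \<in># \<gamma>" using \<gamma> by blast
  have "count (mset_set S) x \<le> 1" using S by (cases "x \<in> S") auto
  then have "k * count \<gamma> x \<le> 1" by (simp add: k)
  moreover have "k * 1 \<le> k * count \<gamma> x"
    using x by (intro mult_le_mono) (simp_all add: Suc_le_eq)
  ultimately have "k = 0 \<or> k = 1" by linarith
  then show ?thesis
  proof
    assume "k = 0"
    then have "S = {}" using k S by (simp add: mset_set_empty_iff)
    then show ?thesis using mfps_coeff_geometric_repeat[OF \<gamma>, of c 0] by simp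
  next
    assume "k = 1"
    then have "mset_set S = \<gamma>" "S \<noteq> {}" using k \<gamma> by auto
    then show ?thesis using mfps_coeff_geometric_repeat[OF \<gamma>, of c 1] by simp
  qed
next
  case False
  then have "mset_set S \<noteq> \<gamma>" "S \<noteq> {}"
    using spec[OF False[unfolded not_ex], of 1] spec[OF False[unfolded not_ex], of 0] by auto
  then show ?thesis using False by (simp add: mfps_coeff_geometric_other)
qed

text \<open>Up to monomials that are not square-free, (1 + c e^\<gamma>)^m is 1 + m c e^\<gamma>.
  This is how multiplicities come to enter linearly.\<close>

lemma mfps_coeff_geometric_power_mset_set:
  assumes \<gamma>: "\<gamma> \<noteq> {#}" and S: "finite S"
  shows "mfps_coeff (mfps_geometric c \<gamma> ^ m) (mset_set S) =
    (if S = {} then 1 else if mset_set S = \<gamma> then of_nat m * c else 0)"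
  using S
proof (induction m arbitrary: S)
  case 0
  then show ?case by (simp add: mfps_coeff_one mset_set_empty_iff)
next
  case (Suc m)
  let ?g = "mfps_geometric c \<gamma>"
  have summand: "mfps_coeff ?g (mset_set A) * mfps_coeff (?g ^ m) (mset_set (S - A)) =
     (if A = {} then (if S = {} then 1 else if mset_set S = \<gamma> then of_nat m * c else 0) else 0)
     + (if A = S then (if S \<noteq> {} \<and> mset_set S = \<gamma> then c else 0) else 0)"
    if A: "A \<subseteq> S" for A
  proof -
    have fin: "finite A" "finite (S - A)" using finite_subset[OF A Suc.prems] Suc.prems by simp_all
    note simps = mfps_coeff_geometric_mset_set[OF \<gamma> fin(1)] Suc.IH[OF fin(2)]
    show ?thesis
    proof (cases "A = {} \<or> A = S")
      case True
      then show ?thesis by (auto simp: simps)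
    next
      case False
      \<comment> \<open>A nonempty block differs from its complement, so they cannot both be
        \<gamma>; products of two linear terms thus contribute nothing.\<close>
      have "A \<noteq> S - A" using False by blast
      then have "mset_set A \<noteq> \<gamma> \<or> mset_set (S - A) \<noteq> \<gamma>"
        using mset_set_eq_iff[OF fin] by auto
      with False A show ?thesis by (auto simp: simps)
    qed
  qed
  have fin: "finite {A. A \<subseteq> S}" using Suc.prems by simp
  have "mfps_coeff (?g ^ Suc m) (mset_set S) =
     (\<Sum>A | A \<subseteq> S. (if A = {} then (if S = {} then 1 else if mset_set S = \<gamma> then of_nat m * c else 0) else 0)
     + (if A = S then (if S \<noteq> {} \<and> mset_set S = \<gamma> then c else 0) else 0))"
    unfolding power_Suc mfps_coeff_mult_mset_set[OF Suc.prems] by (rule sum.cong) (use summand in auto)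
  also have "\<dots> = (if S = {} then 1 else if mset_set S = \<gamma> then of_nat m * c else 0) +
      (if S \<noteq> {} \<and> mset_set S = \<gamma> then c else 0)"
    unfolding sum.distrib using fin by (simp add: sum.delta)
  also have "\<dots> = (if S = {} then 1 else if mset_set S = \<gamma> then of_nat (Suc m) * c else 0)"
    by (auto simp: algebra_simps)
  finally show ?case .
qed

lemma mfps_inverse_power_monom:
  fixes c :: "'c::comm_ring_1"
  assumes "\<gamma> \<noteq> {#}"
  shows "inverse ((1 - mfps_monom c \<gamma>) ^ m) = mfps_geometric c \<gamma> ^ m"
proof (rule mfps_inverse_unique)
  show "(1 - mfps_monom c \<gamma>) ^ m * mfps_geometric c \<gamma> ^ m = 1"
    unfolding power_mult_distrib[symmetric] mfps_geometric_inverse[OF assms] by (rule power_one)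
qed

section \<open>Products of Kostant factors\<close>

context
  fixes m :: "'v multiset \<Rightarrow> nat" and c :: "'c::comm_ring_1"
begin

definition kostant_factor :: "'v multiset \<Rightarrow> ('v, 'c) mfps" where
  "kostant_factor \<gamma> = inverse ((1 - mfps_monom c \<gamma>) ^ m \<gamma>)"

text \<open>At square-free exponents the factor acts as 1 plus
  \<open>of_nat (m \<gamma>) * c\<close> times the monomial of \<gamma>, whatever series
  \<open>g\<close> it multiplies. The later inductions over finite products rest on this
  form.\<close>

lemma mfps_coeff_kostant_factor_mult:
  assumes \<gamma>: "\<gamma> \<noteq> {#}" and S: "finite S"
  shows "mfps_coeff (kostant_factor \<gamma> * g) (mset_set S) = mfps_coeff g (mset_set S) +
    (if \<gamma> \<subseteq># mset_set S then of_nat (m \<gamma>) * c * mfps_coeff g (mset_set S - \<gamma>) else 0)"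
proof -
  have fin: "finite {A. A \<subseteq> S}" using S by simp
  have fac: "mfps_coeff (kostant_factor \<gamma>) (mset_set A) =
    (if A = {} then 1 else 0) + (if mset_set A = \<gamma> then of_nat (m \<gamma>) * c else 0)" if "A \<subseteq> S" for A
    using that S finite_subset[OF that S] \<gamma>
    by (auto simp: kostant_factor_def mfps_inverse_power_monom mfps_coeff_geometric_power_mset_set)
  have "mfps_coeff (kostant_factor \<gamma> * g) (mset_set S) = (\<Sum>A | A \<subseteq> S.
      (if A = {} then mfps_coeff g (mset_set S) else 0) +
      (if mset_set A = \<gamma> then of_nat (m \<gamma>) * c * mfps_coeff g (mset_set S - \<gamma>) else 0))"
    unfolding mfps_coeff_mult_mset_set[OF S]
  proof (rule sum.cong)
    fix A assume "A \<in> {A. A \<subseteq> S}"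
    then have A: "A \<subseteq> S" by simp
    have "mset_set (S - A) = mset_set S - mset_set A"
      using mset_set_Diff[OF S A] by simp
    then show "mfps_coeff (kostant_factor \<gamma>) (mset_set A) * mfps_coeff g (mset_set (S - A)) =
      (if A = {} then mfps_coeff g (mset_set S) else 0) +
      (if mset_set A = \<gamma> then of_nat (m \<gamma>) * c * mfps_coeff g (mset_set S - \<gamma>) else 0)"
      using \<gamma> by (auto simp: fac[OF A])
  qed simp
  also have "\<dots> = mfps_coeff g (mset_set S) + (\<Sum>A | A \<subseteq> S.
      (if mset_set A = \<gamma> then of_nat (m \<gamma>) * c * mfps_coeff g (mset_set S - \<gamma>) else 0))"
    unfolding sum.distrib using fin by (simp add: sum.delta)
  also have "(\<Sum>A | A \<subseteq> S.
      (if mset_set A = \<gamma> then of_nat (m \<gamma>) * c * mfps_coeff g (mset_set S - \<gamma>) else 0)) =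
      (if \<gamma> \<subseteq># mset_set S then of_nat (m \<gamma>) * c * mfps_coeff g (mset_set S - \<gamma>) else 0)"
  proof (cases "\<gamma> \<subseteq># mset_set S")
    case True
    then obtain \<delta> where "\<gamma> + \<delta> = mset_set S" by (metis subset_mset.add_diff_inverse)
    from mset_set_eq_plus[OF S this] have G: "mset_set (set_mset \<gamma>) = \<gamma>" "set_mset \<gamma> \<subseteq> S" by auto
    have "mset_set A = \<gamma> \<longleftrightarrow> A = set_mset \<gamma>" if "A \<subseteq> S" for A
      using G finite_subset[OF that S] by (metis finite_set_mset_mset_set)
    then have "(\<Sum>A | A \<subseteq> S. if mset_set A = \<gamma> then of_nat (m \<gamma>) * c * mfps_coeff g (mset_set S - \<gamma>) else 0)
      = (\<Sum>A | A \<subseteq> S. if A = set_mset \<gamma> then of_nat (m \<gamma>) * c * mfps_coeff g (mset_set S - \<gamma>) else 0)"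
      by (intro sum.cong) auto
    also have "\<dots> = of_nat (m \<gamma>) * c * mfps_coeff g (mset_set S - \<gamma>)"
      using fin G(2) by (simp add: sum.delta)
    finally show ?thesis using True by simp
  next
    case False
    have "mset_set A \<noteq> \<gamma>" if "A \<subseteq> S" for A
      using False that S by (metis mset_set_Diff_add mset_subset_eq_add_left)
    then have "(\<Sum>A | A \<subseteq> S. if mset_set A = \<gamma> then of_nat (m \<gamma>) * c * mfps_coeff g (mset_set S - \<gamma>) else 0) = 0"
      by (intro sum.neutral) auto
    with False show ?thesis by simp
  qed
  finally show ?thesis .
qed

lemma mfps_coeff_prod_empty:
  assumes "finite F" "{#} \<notin> F"
  shows "mfps_coeff (\<Prod>\<gamma>\<in>F. kostant_factor \<gamma>) {#} = 1"
  using assms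
proof (induction F)
  case (insert \<gamma> F)
  then have "\<gamma> \<noteq> {#}" and IH: "mfps_coeff (prod kostant_factor F) {#} = 1" by auto
  from mfps_coeff_kostant_factor_mult[OF this(1) finite.emptyI, of "prod kostant_factor F"] this(1)
  have "mfps_coeff (kostant_factor \<gamma> * prod kostant_factor F) {#} = 1" by (simp add: IH)
  then show ?case unfolding prod.insert[OF insert.hyps] .
qed (simp add: mfps_coeff_one)

text \<open>A factor whose \<gamma> is not contained in the exponent acts as 1. Hence the partial
  products stabilise as soon as they include the finitely many roots below the exponent.\<close>

lemma mfps_coeff_prod_restrict:
  assumes "finite F" "{#} \<notin> F" "finite S"
  shows "mfps_coeff (\<Prod>\<gamma>\<in>F. kostant_factor \<gamma>) (mset_set S) =
    mfps_coeff (\<Prod>\<gamma>\<in>{\<gamma> \<in> F. \<gamma> \<subseteq># mset_set S}. kostant_factor \<gamma>) (mset_set S)"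
proof -
  have fin: "finite {\<gamma> \<in> F. \<gamma> \<subseteq># mset_set S}" using assms(1) by simp
  have "mfps_coeff ((\<Prod>\<gamma>\<in>G. kostant_factor \<gamma>) * g) (mset_set S) = mfps_coeff g (mset_set S)"
    if "finite G" "\<forall>\<gamma>\<in>G. \<not> \<gamma> \<subseteq># mset_set S" "{#} \<notin> G" for G g
    using that
  proof (induction G)
    case (insert \<gamma> G)
    then have "\<gamma> \<noteq> {#}" and IH: "mfps_coeff (prod kostant_factor G * g) (mset_set S) = mfps_coeff g (mset_set S)"
      by auto
    then have "mfps_coeff (kostant_factor \<gamma> * (prod kostant_factor G * g)) (mset_set S) = mfps_coeff g (mset_set S)"
      using mfps_coeff_kostant_factor_mult[of \<gamma> S "prod kostant_factor G * g"] assms(3) insert.prems(1) by simp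
    then show ?case unfolding prod.insert[OF insert.hyps] mult.assoc .
  qed simp
  moreover have "prod kostant_factor F =
      prod kostant_factor (F - {\<gamma> \<in> F. \<gamma> \<subseteq># mset_set S}) * prod kostant_factor {\<gamma> \<in> F. \<gamma> \<subseteq># mset_set S}"
    by (rule prod.subset_diff) (use assms(1) in auto)
  ultimately show ?thesis using assms(1,2) by simp
qed

text \<open>As \<open>r\<close> occurs once in \<open>S\<close>, exactly one factor supplies a
  \<gamma> containing \<open>r\<close>. The remaining exponent avoids \<open>r\<close>, so every
  factor whose exponent contains \<open>r\<close>, that of \<gamma> included, acts as 1 on it; this
  is why the full product may stand on the right.\<close>

lemma mfps_coeff_prod_rec:
  assumes "finite F" "{#} \<notin> F" "finite S" "r \<in> S"
  shows "mfps_coeff (\<Prod>\<gamma>\<in>F. kostant_factor \<gamma>) (mset_set S) =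
    (\<Sum>\<gamma> | \<gamma> \<in> F \<and> r \<in># \<gamma> \<and> \<gamma> \<subseteq># mset_set S.
      of_nat (m \<gamma>) * c * mfps_coeff (\<Prod>\<gamma>\<in>F. kostant_factor \<gamma>) (mset_set S - \<gamma>))"
  using assms
proof (induction F arbitrary: S)
  case empty
  then show ?case by (auto simp: mfps_coeff_one mset_set_empty_iff)
next
  case (insert \<delta> F)
  let ?P = "\<Prod>\<gamma>\<in>F. kostant_factor \<gamma>"
  let ?P' = "\<Prod>\<gamma>\<in>insert \<delta> F. kostant_factor \<gamma>"
  let ?k = "\<lambda>\<gamma>. of_nat (m \<gamma>) * c"
  have \<delta>: "\<delta> \<noteq> {#}" and F: "{#} \<notin> F" using insert.prems by auto
  have P': "?P' = kostant_factor \<delta> * ?P" using insert by simp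
  have diff: "\<exists>T. mset_set S - \<gamma> = mset_set T \<and> finite T \<and> T = S - set_mset \<gamma>"
    if "\<gamma> \<subseteq># mset_set S" "finite S" for \<gamma> S
    using mset_set_eq_plus(2)[of S \<gamma> "mset_set S - \<gamma>"] that by simp
  have step: "mfps_coeff ?P' (mset_set T) = mfps_coeff ?P (mset_set T) +
      (if \<delta> \<subseteq># mset_set T then ?k \<delta> * mfps_coeff ?P (mset_set T - \<delta>) else 0)" if "finite T" for T
    unfolding P' using mfps_coeff_kostant_factor_mult[OF \<delta> that] by simp
  have step': "mfps_coeff ?P' (mset_set S - \<gamma>) = mfps_coeff ?P (mset_set S - \<gamma>) +
      (if \<delta> \<subseteq># mset_set S - \<gamma> then ?k \<delta> * mfps_coeff ?P (mset_set S - \<gamma> - \<delta>) else 0)"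
    if "\<gamma> \<subseteq># mset_set S" for \<gamma>
    using step diff[OF that insert.prems(2)] by metis
  let ?I = "{\<gamma>. \<gamma> \<in> F \<and> r \<in># \<gamma> \<and> \<gamma> \<subseteq># mset_set S}"
  have finI: "finite ?I" using insert.hyps(1) by simp
  have IH: "mfps_coeff ?P (mset_set S) = (\<Sum>\<gamma>\<in>?I. ?k \<gamma> * mfps_coeff ?P (mset_set S - \<gamma>))"
    using insert.IH[OF F insert.prems(2,3)] .
  show ?case
  proof (cases "r \<in># \<delta>")
    case True
    \<comment> \<open>Both \<gamma> and \<delta> contain \<open>r\<close>, of which \<open>S\<close>
      has only one copy.\<close>
    have nsub: "\<not> \<delta> \<subseteq># mset_set S - \<gamma>" if "r \<in># \<gamma>" "\<gamma> \<subseteq># mset_set S" for \<gamma>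
    proof
      assume "\<delta> \<subseteq># mset_set S - \<gamma>"
      then have "r \<in># mset_set S - \<gamma>" using True by (meson mset_subset_eqD)
      then show False using diff[OF that(2) insert.prems(2)] that(1) by auto
    qed
    have eq: "mfps_coeff ?P' (mset_set S - \<gamma>) = mfps_coeff ?P (mset_set S - \<gamma>)"
      if "r \<in># \<gamma>" "\<gamma> \<subseteq># mset_set S" for \<gamma>
      using step'[OF that(2)] nsub[OF that] by simp
    let ?J = "if \<delta> \<subseteq># mset_set S then insert \<delta> ?I else ?I"
    have setI: "{\<gamma>. \<gamma> \<in> insert \<delta> F \<and> r \<in># \<gamma> \<and> \<gamma> \<subseteq># mset_set S} = ?J"
      using True by auto
    have mem: "r \<in># \<gamma> \<and> \<gamma> \<subseteq># mset_set S" if "\<gamma> \<in> ?J" for \<gamma>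
      using that unfolding setI[symmetric] by blast
    have "(\<Sum>\<gamma> | \<gamma> \<in> insert \<delta> F \<and> r \<in># \<gamma> \<and> \<gamma> \<subseteq># mset_set S.
        ?k \<gamma> * mfps_coeff ?P' (mset_set S - \<gamma>)) =
      (\<Sum>\<gamma>\<in>?J. ?k \<gamma> * mfps_coeff ?P (mset_set S - \<gamma>))"
      by (rule sum.cong[OF setI]) (use eq mem in metis)
    also have "\<dots> = mfps_coeff ?P' (mset_set S)"
      unfolding step[OF insert.prems(2)] IH using insert.hyps(2) finI by (simp add: add.commute)
    finally show ?thesis by simp
  next
    case False
    have setI: "{\<gamma>. \<gamma> \<in> insert \<delta> F \<and> r \<in># \<gamma> \<and> \<gamma> \<subseteq># mset_set S} = ?I"
      using False by auto
    have "(\<Sum>\<gamma> | \<gamma> \<in> insert \<delta> F \<and> r \<in># \<gamma> \<and> \<gamma> \<subseteq># mset_set S.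
        ?k \<gamma> * mfps_coeff ?P' (mset_set S - \<gamma>)) =
      (\<Sum>\<gamma>\<in>?I. ?k \<gamma> * mfps_coeff ?P (mset_set S - \<gamma>) +
        (if \<delta> \<subseteq># mset_set S - \<gamma> then ?k \<delta> * (?k \<gamma> * mfps_coeff ?P (mset_set S - \<delta> - \<gamma>)) else 0))"
    proof (rule sum.cong[OF setI])
      fix \<gamma> assume "\<gamma> \<in> ?I"
      then have "\<gamma> \<subseteq># mset_set S" by blast
      from step'[OF this] show "?k \<gamma> * mfps_coeff ?P' (mset_set S - \<gamma>) =
        ?k \<gamma> * mfps_coeff ?P (mset_set S - \<gamma>) +
        (if \<delta> \<subseteq># mset_set S - \<gamma> then ?k \<delta> * (?k \<gamma> * mfps_coeff ?P (mset_set S - \<delta> - \<gamma>)) else 0)"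
        by (simp only: distrib_left diff_right_commute[of _ \<delta> \<gamma>] if_distrib[of "\<lambda>x. _ * x"]
            mult_zero_right mult.left_commute[of "?k \<gamma>" "?k \<delta>"])
    qed
    also have "\<dots> = mfps_coeff ?P (mset_set S) + (\<Sum>\<gamma>\<in>?I.
        if \<delta> \<subseteq># mset_set S - \<gamma> then ?k \<delta> * (?k \<gamma> * mfps_coeff ?P (mset_set S - \<delta> - \<gamma>)) else 0)"
      by (simp only: sum.distrib IH)
    also have "(\<Sum>\<gamma>\<in>?I.
        if \<delta> \<subseteq># mset_set S - \<gamma> then ?k \<delta> * (?k \<gamma> * mfps_coeff ?P (mset_set S - \<delta> - \<gamma>)) else 0) =
      (if \<delta> \<subseteq># mset_set S then ?k \<delta> * mfps_coeff ?P (mset_set S - \<delta>) else 0)"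
    proof (cases "\<delta> \<subseteq># mset_set S")
      case True
      obtain T where T: "mset_set S - \<delta> = mset_set T" "finite T" "T = S - set_mset \<delta>"
        using diff[OF True insert.prems(2)] by blast
      \<comment> \<open>Since \<delta> does not contain \<open>r\<close>, the vertex survives in
        \<open>T\<close> and the induction hypothesis applies to \<open>T\<close> as well.\<close>
      have "r \<in> T" using T False insert.prems by simp
      have sub: "\<delta> \<subseteq># mset_set S - \<gamma> \<longleftrightarrow> \<gamma> \<subseteq># mset_set S - \<delta>" if "\<gamma> \<subseteq># mset_set S" for \<gamma>
        using that True by (simp add: subset_mset.le_diff_conv2 add.commute)
      have "(\<Sum>\<gamma>\<in>?I. if \<delta> \<subseteq># mset_set S - \<gamma> then ?k \<delta> * (?k \<gamma> * mfps_coeff ?P (mset_set S - \<delta> - \<gamma>)) else 0) =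
        (\<Sum>\<gamma>\<in>?I \<inter> {\<gamma>. \<delta> \<subseteq># mset_set S - \<gamma>}. ?k \<delta> * (?k \<gamma> * mfps_coeff ?P (mset_set S - \<delta> - \<gamma>)))"
        using sum.inter_restrict[OF finI, of "\<lambda>\<gamma>. ?k \<delta> * (?k \<gamma> * mfps_coeff ?P (mset_set S - \<delta> - \<gamma>))"
            "{\<gamma>. \<delta> \<subseteq># mset_set S - \<gamma>}"] by (simp only: mem_Collect_eq)
      also have "?I \<inter> {\<gamma>. \<delta> \<subseteq># mset_set S - \<gamma>} = {\<gamma> \<in> F. r \<in># \<gamma> \<and> \<gamma> \<subseteq># mset_set T}"
      proof -
        have "\<gamma> \<subseteq># mset_set S" if "\<gamma> \<subseteq># mset_set T" for \<gamma>
          using that T(1) by (metis diff_subset_eq_self subset_mset.order_trans)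
        then show ?thesis using sub T(1) by auto
      qed
      also have "(\<Sum>\<gamma>\<in>\<dots>. ?k \<delta> * (?k \<gamma> * mfps_coeff ?P (mset_set S - \<delta> - \<gamma>))) =
          ?k \<delta> * mfps_coeff ?P (mset_set T)"
        unfolding insert.IH[OF F T(2) \<open>r \<in> T\<close>] T(1) sum_distrib_left ..
      finally show ?thesis using True T(1) by simp
    next
      case False
      then have "\<not> \<delta> \<subseteq># mset_set S - \<gamma>" for \<gamma>
        by (meson diff_subset_eq_self subset_mset.order_trans)
      with False show ?thesis by simp
    qed
    finally show ?thesis unfolding step[OF insert.prems(2)] by simp
  qed
qed

end

text \<open>The limit is unique because the filter of finite subsets is proper: two values that are
  both attained eventually are attained at a common set.\<close>

lemma mfps_infprod_coeff_eqI:
  assumes "finite F0" "F0 \<subseteq> A"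
    and "\<And>F. finite F \<Longrightarrow> F0 \<subseteq> F \<Longrightarrow> F \<subseteq> A \<Longrightarrow> mfps_coeff (\<Prod>\<alpha>\<in>F. f \<alpha>) \<beta> = c"
  shows "mfps_infprod_coeff f A \<beta> = c"
  unfolding mfps_infprod_coeff_def
proof (rule the_equality)
  show ev: "\<forall>\<^sub>F F in finite_subsets_at_top A. mfps_coeff (\<Prod>\<alpha>\<in>F. f \<alpha>) \<beta> = c"
    unfolding eventually_finite_subsets_at_top using assms by blast
  fix c' assume "\<forall>\<^sub>F F in finite_subsets_at_top A. mfps_coeff (\<Prod>\<alpha>\<in>F. f \<alpha>) \<beta> = c'"
  with ev have "\<forall>\<^sub>F F in finite_subsets_at_top A. c' = c" by eventually_elim simp
  then show "c' = c" by simp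
qed

section \<open>A module satisfying the Chevalley--Serre relations\<close>

lemma cartan_matrix_nth:
  assumes "simple_graph E"
  shows "cartan_matrix E $ i $ j = (if i = j then 2 else if E i j then - 1 else 0)"
  using assms
  by (auto simp: cartan_matrix_def adjacency_matrix_def mat_def simple_graph_def irreflp_def)

locale realization =
  fixes E :: "'v::finite \<Rightarrow> 'v \<Rightarrow> bool"
    and scaleH :: "complex \<Rightarrow> 'h::ab_group_add \<Rightarrow> 'h"
    and \<alpha> :: "'v \<Rightarrow> 'h \<Rightarrow> complex" and h :: "'v \<Rightarrow> 'h"
  assumes graph: "simple_graph E"
    and min_real: "minimal_realization (cartan_matrix E) scaleH \<alpha> h"
begin

lemma E_sym: "E i j \<longleftrightarrow> E j i"
  using graph by (metis simple_graph_def sympD)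

lemma E_irrefl [simp]: "\<not> E i i"
  using graph by (simp add: simple_graph_def irreflp_def)

lemma linear_\<alpha>: "Vector_Spaces.linear scaleH (*) (\<alpha> i)"
  using min_real by (simp add: minimal_realization_def)

lemma \<alpha>_add [simp]: "\<alpha> i (x + y) = \<alpha> i x + \<alpha> i y"
  and \<alpha>_scale [simp]: "\<alpha> i (scaleH c x) = c * \<alpha> i x"
proof -
  interpret Vector_Spaces.linear scaleH "(*)" "\<alpha> i" by (rule linear_\<alpha>)
  show "\<alpha> i (x + y) = \<alpha> i x + \<alpha> i y" by (rule add)
  show "\<alpha> i (scaleH c x) = c * \<alpha> i x" by (rule scale)
qed

lemma \<alpha>_h: "\<alpha> j (h i) = (if i = j then 2 else if E i j then - 1 else 0)"
  using min_real by (simp add: minimal_realization_def cartan_matrix_nth[OF graph])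

text \<open>
  The operators act on the dual of the tensor algebra, viewed as Verma module of highest weight 0:
  on functions on words in the vertices. The recursion for \<open>opF\<close> is forced by
  \<open>[e\<^sub>i, f\<^sub>j] = \<delta>\<^sub>i\<^sub>j h\<^sub>i\<close>.
\<close>

definition wt :: "'v list \<Rightarrow> 'h \<Rightarrow> complex" where
  "wt w x = (\<Sum>j\<leftarrow>w. \<alpha> j x)"

definition opE :: "'v \<Rightarrow> ('v list \<Rightarrow> complex) \<Rightarrow> 'v list \<Rightarrow> complex" where
  "opE i \<phi> w = \<phi> (i # w)"

definition opH :: "'h \<Rightarrow> ('v list \<Rightarrow> complex) \<Rightarrow> 'v list \<Rightarrow> complex" where
  "opH x \<phi> w = - wt w x * \<phi> w"

fun opF :: "'v \<Rightarrow> ('v list \<Rightarrow> complex) \<Rightarrow> 'v list \<Rightarrow> complex" where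
  "opF j \<phi> [] = 0"
| "opF j \<phi> (i # w) = opF j (opE i \<phi>) w + (if i = j then opH (h i) \<phi> w else 0)"

lemma wt_Nil [simp]: "wt [] x = 0"
  and wt_Cons [simp]: "wt (i # w) x = \<alpha> i x + wt w x"
  by (simp_all add: wt_def)

lemma opE_lin: "opE i (\<lambda>w. a * \<phi> w + b * \<psi> w) = (\<lambda>w. a * opE i \<phi> w + b * opE i \<psi> w)"
  by (simp add: opE_def fun_eq_iff)

lemma opH_lin: "opH x (\<lambda>w. a * \<phi> w + b * \<psi> w) = (\<lambda>w. a * opH x \<phi> w + b * opH x \<psi> w)"
  by (simp add: opH_def fun_eq_iff algebra_simps)

lemma opF_lin': "opF j (\<lambda>w. a * \<phi> w + b * \<psi> w) w = a * opF j \<phi> w + b * opF j \<psi> w"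
  by (induction w arbitrary: \<phi> \<psi>) (simp_all add: opE_lin opH_lin algebra_simps)

lemma opF_lin: "opF j (\<lambda>w. a * \<phi> w + b * \<psi> w) = (\<lambda>w. a * opF j \<phi> w + b * opF j \<psi> w)"
  by (simp add: fun_eq_iff opF_lin')

lemma opF_add: "opF j (\<lambda>w. \<phi> w + \<psi> w) w = opF j \<phi> w + opF j \<psi> w"
  using opF_lin'[of j 1 \<phi> 1 \<psi> w] by simp

lemma opF_scale: "opF j (\<lambda>w. a * \<phi> w) w = a * opF j \<phi> w"
  using opF_lin'[of j a \<phi> 0 \<phi> w] by simp

lemma opF_diff: "opF j (\<lambda>w. \<phi> w - \<psi> w) w = opF j \<phi> w - opF j \<psi> w"
  using opF_lin'[of j 1 \<phi> "- 1" \<psi> w] by simp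

lemma opF_zero: "opF j (\<lambda>w. 0) w = 0"
  using opF_scale[of j 0 "\<lambda>w. 0" w] by simp

lemma opE_opF: "opE i (opF j \<phi>) = (\<lambda>w. opF j (opE i \<phi>) w + (if i = j then opH (h i) \<phi> w else 0))"
  by (simp add: fun_eq_iff opE_def)

lemma opE_opH: "opE i (opH x \<phi>) = (\<lambda>w. opH x (opE i \<phi>) w + - \<alpha> i x * opE i \<phi> w)"
  by (simp add: fun_eq_iff opE_def opH_def algebra_simps)

lemma opF_opH: "opF j (opH x \<phi>) w = opH x (opF j \<phi>) w + \<alpha> j x * opF j \<phi> w"
proof (induction w arbitrary: \<phi>)
  case (Cons i w)
  have "opF j (opE i (opH x \<phi>)) w = opF j (opH x (opE i \<phi>)) w + - \<alpha> i x * opF j (opE i \<phi>) w"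
    by (simp only: opE_opH opF_add opF_scale)
  then have "opF j (opH x \<phi>) (i # w) = opH x (opF j (opE i \<phi>)) w + \<alpha> j x * opF j (opE i \<phi>) w +
      - \<alpha> i x * opF j (opE i \<phi>) w + (if i = j then opH (h i) (opH x \<phi>) w else 0)"
    by (simp only: opF.simps Cons[of "opE i \<phi>"])
  also have "\<dots> = opH x (opF j \<phi>) (i # w) + \<alpha> j x * opF j \<phi> (i # w)"
    unfolding opH_def[of x "opF j (opE i \<phi>)" w] opH_def[of "h i" "opH x \<phi>" w] opH_def[of x \<phi> w]
      opH_def[of x "opF j \<phi>" "i # w"] opF.simps(2)[of j \<phi> i w] opH_def[of "h i" \<phi> w]
    by (simp add: algebra_simps)
  finally show ?case .
qed (simp add: opH_def)

section \<open>The subspace cut out by the Serre relations among the e\<close>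

definition serre_op :: "'v \<Rightarrow> 'v \<Rightarrow> ('v list \<Rightarrow> complex) \<Rightarrow> 'v list \<Rightarrow> complex" where
  "serre_op i j \<phi> w = (if E i j then \<phi> (i # i # j # w) - 2 * \<phi> (i # j # i # w) + \<phi> (j # i # i # w)
    else \<phi> (i # j # w) - \<phi> (j # i # w))"

text \<open>\<open>serre_op\<close> pairs a function with the Serre element of \<open>i\<close> and
  \<open>j\<close> followed by \<open>w\<close>. With the prefix \<open>u\<close> as well, these are
  the functions vanishing on the two-sided ideal generated by the Serre elements, that is, the dual
  of the quotient of the tensor algebra by this ideal.\<close>

definition serre_module :: "('v list \<Rightarrow> complex) set" where
  "serre_module = {\<phi>. \<forall>i j u w. i \<noteq> j \<longrightarrow> serre_op i j (\<lambda>v. \<phi> (u @ v)) w = 0}"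

lemma serre_moduleD: "\<phi> \<in> serre_module \<Longrightarrow> i \<noteq> j \<Longrightarrow> serre_op i j (\<lambda>v. \<phi> (u @ v)) w = 0"
  by (simp add: serre_module_def)

lemma serre_module_lin:
  assumes "\<phi> \<in> serre_module" "\<psi> \<in> serre_module"
  shows "(\<lambda>w. a * \<phi> w + b * \<psi> w) \<in> serre_module"
proof -
  have "serre_op i j (\<lambda>v. a * \<phi> (u @ v) + b * \<psi> (u @ v)) w =
    a * serre_op i j (\<lambda>v. \<phi> (u @ v)) w + b * serre_op i j (\<lambda>v. \<psi> (u @ v)) w" for i j u w
    by (simp add: serre_op_def algebra_simps)
  with assms show ?thesis by (simp add: serre_module_def)
qed

lemma serre_module_opE:
  assumes "\<phi> \<in> serre_module"
  shows "opE i \<phi> \<in> serre_module"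
proof -
  have "serre_op k l (\<lambda>v. opE i \<phi> (u @ v)) w = 0" if "k \<noteq> l" for k l u w
    using serre_moduleD[OF assms that, of "i # u" w] by (simp add: opE_def)
  then show ?thesis by (simp add: serre_module_def)
qed

lemma wt_append [simp]: "wt (u @ v) x = wt u x + wt v x"
  by (simp add: wt_def)

text \<open>All words occurring in one Serre element have the same weight, so \<open>opH x\<close>
  multiplies the whole expression by a scalar.\<close>

lemma serre_module_opH:
  assumes "\<phi> \<in> serre_module"
  shows "opH x \<phi> \<in> serre_module"
proof -
  have "serre_op i j (\<lambda>v. opH x \<phi> (u @ v)) w =
      - wt (u @ (if E i j then [i, i, j] else [i, j]) @ w) x * serre_op i j (\<lambda>v. \<phi> (u @ v)) w" for i j u w
    by (simp add: serre_op_def opH_def algebra_simps)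
  with assms show ?thesis by (simp add: serre_module_def)
qed

text \<open>This is the classical fact that each f commutes with the Serre elements formed from the
  e. Moving \<open>opF k\<close> past every \<open>opE\<close> leaves Cartan terms, and these cancel
  by the values 2, -1, 0 in \<open>\<alpha>_h\<close>.\<close>

lemma serre_op_opF:
  assumes "i \<noteq> j"
  shows "serre_op i j (opF k \<phi>) w = opF k (serre_op i j \<phi>) w"
proof (cases "E i j")
  case True
  have "serre_op i j \<phi> = (\<lambda>w. 1 * (opE j (opE i (opE i \<phi>)) w) + 1 *
      ((- 2) * opE i (opE j (opE i \<phi>)) w + 1 * opE i (opE i (opE j \<phi>)) w))"
    using True by (simp add: fun_eq_iff serre_op_def opE_def)
  then have "opF k (serre_op i j \<phi>) w = opF k (opE j (opE i (opE i \<phi>))) w - 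
      2 * opF k (opE i (opE j (opE i \<phi>))) w + opF k (opE i (opE i (opE j \<phi>))) w"
    by (simp only: opF_lin') simp
  moreover have "E j i" using True E_sym by blast
  ultimately show ?thesis using True assms
    by (auto simp: serre_op_def opE_def opH_def \<alpha>_h algebra_simps)
next
  case False
  have "serre_op i j \<phi> = (\<lambda>w. 1 * (opE j (opE i \<phi>) w) + (- 1) * opE i (opE j \<phi>) w)"
    using False by (simp add: fun_eq_iff serre_op_def opE_def)
  then have "opF k (serre_op i j \<phi>) w = opF k (opE j (opE i \<phi>)) w - opF k (opE i (opE j \<phi>)) w"
    by (simp only: opF_lin') simp
  moreover have "\<not> E j i" using False E_sym by blast
  ultimately show ?thesis using False assms
    by (auto simp: serre_op_def opE_def opH_def \<alpha>_h algebra_simps)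
qed

text \<open>Induction on the prefix \<open>u\<close>. Reading off a letter \<open>l\<close> replaces
  \<phi> by \<open>opE l \<phi>\<close> and possibly adds a term with
  \<open>opH (h l) \<phi>\<close>; both functions remain in the module. The empty prefix is the
  commutation with \<open>serre_op\<close>.\<close>

lemma serre_module_opF:
  assumes "\<phi> \<in> serre_module"
  shows "opF k \<phi> \<in> serre_module"
proof -
  have "serre_op i j (\<lambda>v. opF k \<phi> (u @ v)) w = 0" if "i \<noteq> j" for i j u w
    using assms
  proof (induction u arbitrary: \<phi>)
    case Nil
    have "serre_op i j \<phi> = (\<lambda>w. 0)"
      using serre_moduleD[OF Nil \<open>i \<noteq> j\<close>, of "[]"] by (simp add: fun_eq_iff)
    then show ?case using serre_op_opF[OF \<open>i \<noteq> j\<close>, of k \<phi> w] by (simp add: opF_zero)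
  next
    case (Cons l u)
    have "serre_op i j (\<lambda>v. opF k \<phi> ((l # u) @ v)) w =
        serre_op i j (\<lambda>v. opF k (opE l \<phi>) (u @ v)) w +
        (if l = k then serre_op i j (\<lambda>v. opH (h l) \<phi> (u @ v)) w else 0)"
      by (simp add: serre_op_def algebra_simps)
    then show ?case
      using Cons.IH[OF serre_module_opE[OF Cons.prems]]
        serre_moduleD[OF serre_module_opH[OF Cons.prems] \<open>i \<noteq> j\<close>] by simp
  qed
  then show ?thesis by (simp add: serre_module_def)
qed

text \<open>
  The \<open>f\<close>-Serre relations hold on all functions: by the \<open>e\<close>-\<open>f\<close> relations their left hand
  sides commute with all \<open>e\<^sub>k\<close>, and they vanish at the empty word.
\<close>

lemma opF_commute:
  assumes "i \<noteq> j" "\<not> E i j"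
  shows "opF i (opF j \<phi>) w = opF j (opF i \<phi>) w"
proof (induction w arbitrary: \<phi>)
  case (Cons k w)
  have ji: "\<not> E j i" using assms E_sym by blast
  have "opF i (opF j \<phi>) (k # w) = opF i (opF j (opE k \<phi>)) w +
      (if k = j then opF i (opH (h j) \<phi>) w else 0) + (if k = i then opH (h i) (opF j \<phi>) w else 0)"
    by (auto simp: opE_opF opF_add opF_zero)
  moreover have "opF j (opF i \<phi>) (k # w) = opF j (opF i (opE k \<phi>)) w +
      (if k = i then opF j (opH (h i) \<phi>) w else 0) + (if k = j then opH (h j) (opF i \<phi>) w else 0)"
    by (auto simp: opE_opF opF_add opF_zero)
  ultimately show ?case using Cons[of "opE k \<phi>"] assms ji
    by (auto simp: opF_opH \<alpha>_h)
qed simp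

lemma opF_serre:
  assumes "i \<noteq> j" "E i j"
  shows "opF i (opF i (opF j \<phi>)) w - 2 * opF i (opF j (opF i \<phi>)) w + opF j (opF i (opF i \<phi>)) w = 0"
proof (induction w arbitrary: \<phi>)
  case (Cons k w)
  have ji: "E j i" using assms E_sym by blast
  \<comment> \<open>Evaluation at \<open>k # w\<close> moves \<open>opE k\<close> inwards past three
    operators; each one with index \<open>k\<close> leaves a Cartan term at its place.\<close>
  have F3: "opF a (opF b (opF c \<phi>)) (k # w) = opF a (opF b (opF c (opE k \<phi>))) w +
      (if k = c then opF a (opF b (opH (h c) \<phi>)) w else 0) +
      (if k = b then opF a (opH (h b) (opF c \<phi>)) w else 0) +
      (if k = a then opH (h a) (opF b (opF c \<phi>)) w else 0)" for a b c
  proof -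
    have "opE k (opF b (opF c \<phi>)) = (\<lambda>w. opF b (opF c (opE k \<phi>)) w +
        ((if k = c then opF b (opH (h c) \<phi>) w else 0) + (if k = b then opH (h b) (opF c \<phi>) w else 0)))"
      by (auto simp: opE_opF opF_add opF_zero fun_eq_iff)
    then show ?thesis by (auto simp: opF_add opF_zero)
  qed
  have HF: "opF b (opH x \<phi>) = (\<lambda>w. opH x (opF b \<phi>) w + \<alpha> b x * opF b \<phi> w)" for b x \<phi>
    by (simp add: fun_eq_iff opF_opH)
  show ?case using Cons[of "opE k \<phi>"] assms ji unfolding F3
    by (auto simp: HF opF_add opF_diff opF_scale opF_opH \<alpha>_h algebra_simps)
qed simp

section \<open>The action of Lie expressions\<close>

primrec op_gen :: "('h, 'v) km_gen \<Rightarrow> ('v list \<Rightarrow> complex) \<Rightarrow> 'v list \<Rightarrow> complex" where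
  "op_gen (GenH x) = opH x"
| "op_gen (GenE i) = opE i"
| "op_gen (GenF i) = opF i"

text \<open>The action is defined on expressions rather than on the algebra, so that its being well
  defined becomes soundness of \<open>lie_derivable\<close>.\<close>

primrec act :: "('h, 'v) km_gen lie_expr \<Rightarrow> ('v list \<Rightarrow> complex) \<Rightarrow> 'v list \<Rightarrow> complex" where
  "act (Gen g) \<phi> = op_gen g \<phi>"
| "act LZero \<phi> = (\<lambda>w. 0)"
| "act (LAdd s t) \<phi> = (\<lambda>w. act s \<phi> w + act t \<phi> w)"
| "act (LScale c t) \<phi> = (\<lambda>w. c * act t \<phi> w)"
| "act (LBr s t) \<phi> = (\<lambda>w. act s (act t \<phi>) w - act t (act s \<phi>) w)"

lemma act_lin: "act s (\<lambda>w. a * \<phi> w + b * \<psi> w) = (\<lambda>w. a * act s \<phi> w + b * act s \<psi> w)"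
proof (induction s arbitrary: a b \<phi> \<psi>)
  case (Gen g)
  then show ?case by (cases g) (simp_all add: opE_lin opH_lin opF_lin)
qed (simp_all add: algebra_simps)

lemma act_add: "act s (\<lambda>w. \<phi> w + \<psi> w) = (\<lambda>w. act s \<phi> w + act s \<psi> w)"
  using act_lin[of s 1 \<phi> 1 \<psi>] by simp

lemma act_scale: "act s (\<lambda>w. a * \<phi> w) = (\<lambda>w. a * act s \<phi> w)"
  using act_lin[of s a \<phi> 0 \<phi>] by simp

lemma act_diff: "act s (\<lambda>w. \<phi> w - \<psi> w) = (\<lambda>w. act s \<phi> w - act s \<psi> w)"
  using act_lin[of s 1 \<phi> "- 1" \<psi>] by simp

lemma act_zero: "act s (\<lambda>w. 0) = (\<lambda>w. 0)"
  using act_scale[of s 0 "\<lambda>w. 0"] by simp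

lemma act_serre_module: "\<phi> \<in> serre_module \<Longrightarrow> act s \<phi> \<in> serre_module"
proof (induction s arbitrary: \<phi>)
  case (Gen g)
  then show ?case by (cases g) (simp_all add: serre_module_opE serre_module_opF serre_module_opH)
next
  case LZero
  then show ?case using serre_module_lin[of \<phi> \<phi> 0 0] by simp
next
  case (LAdd s t)
  then show ?case using serre_module_lin[of "act s \<phi>" "act t \<phi>" 1 1] by simp
next
  case (LScale c t)
  then show ?case using serre_module_lin[of "act t \<phi>" "act t \<phi>" c 0] by simp
next
  case (LBr s t)
  then show ?case using serre_module_lin[of "act s (act t \<phi>)" "act t (act s \<phi>)" 1 "- 1"] by simp
qed

text \<open>Membership of \<phi> in \<open>serre_module\<close> enters at the Serre relations among
  the e; those among the f come from \<open>opF_serre\<close> and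
  \<open>opF_commute\<close>.\<close>

lemma act_relations:
  assumes "(s, t) \<in> chevalley_serre_relations (cartan_matrix E) scaleH \<alpha> h" and \<phi>: "\<phi> \<in> serre_module"
  shows "act s \<phi> = act t \<phi>"
  using assms(1)
proof cases
  case (H_add x y)
  then show ?thesis by (simp add: opH_def wt_def fun_eq_iff algebra_simps sum_list_addf)
next
  case (H_scale c x)
  then show ?thesis by (simp add: opH_def wt_def fun_eq_iff sum_list_const_mult)
next
  case (HH x y)
  then show ?thesis by (simp add: opH_def fun_eq_iff)
next
  case (HE x i)
  then show ?thesis by (simp add: opE_opH fun_eq_iff)
next
  case (HF x i)
  then show ?thesis by (simp add: opF_opH fun_eq_iff)
next
  case (EF i j)
  then show ?thesis by (auto simp: opE_opF fun_eq_iff)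
next
  case (serre_E i j)
  have "serre_op j i \<phi> w = 0" "serre_op i j \<phi> w = 0" for w
    using serre_moduleD[OF \<phi>, of _ _ "[]"] serre_E(3) by auto
  moreover have "E j i = E i j" by (rule E_sym)
  ultimately show ?thesis using serre_E
    by (auto simp: cartan_matrix_nth[OF graph] numeral_2_eq_2 fun_eq_iff serre_op_def opE_def algebra_simps)
next
  case (serre_F i j)
  then show ?thesis
    using opF_serre[of i j \<phi>] opF_commute[of i j \<phi>]
    by (auto simp: cartan_matrix_nth[OF graph] numeral_2_eq_2 fun_eq_iff act_diff opF_lin' algebra_simps)
qed

text \<open>The induction is over all \<phi> in the module at once: for the congruence rule of
  brackets the hypothesis is applied to \<open>act t \<phi>\<close>, which again lies there by
  \<open>act_serre_module\<close>.\<close>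

lemma act_derivable:
  assumes "lie_derivable (chevalley_serre_relations (cartan_matrix E) scaleH \<alpha> h) s t"
    and "\<phi> \<in> serre_module"
  shows "act s \<phi> = act t \<phi>"
  using assms
proof (induction arbitrary: \<phi> rule: lie_derivable.induct)
  case (rel s t)
  then show ?case by (rule act_relations)
next
  case (cong_br s s' t t')
  then have "act s (act t \<phi>) = act s' (act t' \<phi>)" "act t (act s \<phi>) = act t' (act s' \<phi>)"
    using act_serre_module by metis+
  then show ?case by simp
qed (simp_all add: act_add act_scale act_diff act_zero fun_eq_iff algebra_simps)

end

section \<open>Nested brackets\<close>

context vector_space
begin

text \<open>Applying \<open>L p\<close> to a vanishing combination isolates the coefficient of
  \<open>b p\<close>. Duality also makes \<open>b\<close> injective, so its image has
  \<open>card U\<close> elements.\<close>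

lemma dim_span_dual_family:
  assumes "finite U"
    and L_add: "\<And>p x y. p \<in> U \<Longrightarrow> L p (x + y) = L p x + L p y"
    and L_scale: "\<And>p c x. p \<in> U \<Longrightarrow> L p (scale c x) = c * L p x"
    and dual: "\<And>p q. p \<in> U \<Longrightarrow> q \<in> U \<Longrightarrow> L p (b q) = (if p = q then 1 else 0)"
  shows "dim (span (b ` U)) = card U"
proof -
  have inj: "inj_on b U" using dual by (metis inj_onI one_neq_zero)
  have "independent (b ` U)"
  proof (rule independent_if_scalars_zero)
    show "finite (b ` U)" using assms(1) by simp
    fix g x assume sum: "(\<Sum>x\<in>b ` U. scale (g x) x) = 0" and "x \<in> b ` U"
    then obtain p where p: "p \<in> U" "x = b p" by blast
    have zero: "L p 0 = 0" using L_scale[OF p(1), of 0 0] by simp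
    have L_sum: "L p (\<Sum>q\<in>V. scale (g (b q)) (b q)) = (\<Sum>q\<in>V. g (b q) * L p (b q))"
      if "finite V" for V
      using that by (induction V) (simp_all add: zero L_add[OF p(1)] L_scale[OF p(1)])
    have "0 = L p (\<Sum>q\<in>U. scale (g (b q)) (b q))"
      using sum zero by (simp add: sum.reindex[OF inj])
    also have "\<dots> = (\<Sum>q\<in>U. if p = q then g (b q) else 0)"
      unfolding L_sum[OF assms(1)] by (rule sum.cong) (use dual[OF p(1)] in auto)
    also have "\<dots> = g (b p)" using assms(1) p(1) by simp
    finally show "g x = 0" using p(2) by simp
  qed
  then show ?thesis using dim_span_eq_card_independent card_image[OF inj] by metis
qed

end

context lie_algebra
begin

lemma br_zero_left [simp]: "br 0 y = 0"
  using br_add_left[of 0 0 y] by simp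

lemma br_zero_right [simp]: "br y 0 = 0"
  using br_add_right[of y 0 0] by simp

lemma br_anti: "br x y = - br y x"
  using br_self[of "x + y"] br_self[of x] br_self[of y]
  by (simp add: br_add_left br_add_right add_eq_0_iff2 add.commute)

lemma br_minus_right: "br x (- y) = - br x y"
  using br_add_right[of x "- y" y] by (simp add: eq_neg_iff_add_eq_0)

lemma br_deriv: "br x (br y z) = br (br x y) z + br y (br x z)"
proof -
  have "br x (br y z) = - br y (br z x) - br z (br x y)"
    using jacobi[of x y z] by (simp add: eq_neg_iff_add_eq_0 eq_diff_eq add_ac)
  also have "\<dots> = br y (br x z) + br (br x y) z"
    using br_anti[of z x] br_anti[of z "br x y"] by (simp add: br_minus_right)
  finally show ?thesis by simp
qed

lemma br_br_left: "br (br x y) z = br x (br y z) - br y (br x z)"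
  using br_deriv[of x y z] by simp

lemma br_span_right:
  assumes "y \<in> span M" "subspace W" "\<And>m. m \<in> M \<Longrightarrow> br x m \<in> W"
  shows "br x y \<in> W"
  using assms(1)
proof (induction rule: span_induct_alt)
  case base
  then show ?case using subspace_0[OF assms(2)] by simp
next
  case (step c m y)
  then show ?case
    using assms(3) subspace_add[OF assms(2)] subspace_scale[OF assms(2)]
    by (simp add: br_add_right br_scale_right)
qed

text \<open>The first letter of the word is applied first, so it ends up innermost.\<close>

primrec nest :: "('v \<Rightarrow> 'g) \<Rightarrow> 'g \<Rightarrow> 'v list \<Rightarrow> 'g" where
  "nest a x [] = x"
| "nest a x (i # v) = nest a (br (a i) x) v"

lemma nest_append: "nest a x (u @ v) = nest a (nest a x u) v"
  by (induction u arbitrary: x) simp_all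

lemma nest_snoc [simp]: "nest a x (v @ [i]) = br (a i) (nest a x v)"
  by (simp add: nest_append)

lemma nest_zero [simp]: "nest a 0 v = 0"
  by (induction v) simp_all

definition nests :: "('v \<Rightarrow> 'g) \<Rightarrow> 'g set" where
  "nests a = {nest a (a r) v | r v. True}"

lemma nestsI: "nest a (a r) v \<in> nests a"
  by (auto simp: nests_def)

lemma br_nests: "y \<in> nests a \<Longrightarrow> br (a i) y \<in> nests a"
  using nestsI[of a _ "_ @ [i]"] unfolding nests_def by auto

lemma br_span_nests: "y \<in> span (nests a) \<Longrightarrow> br (a i) y \<in> span (nests a)"
  by (rule br_span_right) (auto intro: span_base br_nests)

text \<open>Used with both \<open>(a, b) = (e, f)\<close> and \<open>(a, b) = (f, e)\<close> for the triangular decomposition.\<close>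

lemma nests_stable:
  assumes K: "subspace K"
    and Ka: "\<And>x i. x \<in> K \<Longrightarrow> \<exists>c. br x (a i) = scaleG c (a i)"
    and ba: "\<And>i j. br (b j) (a i) \<in> K"
  shows "x \<in> K \<Longrightarrow> br x (nest a (a r) v) \<in> span (nests a)"
    and "br (b j) (nest a (a r) v) \<in> span (nests a \<union> K)"
    and "x \<in> K \<Longrightarrow> br (a i) x \<in> span (nests a)"
proof -
  have gen: "a i \<in> nests a" for i using nestsI[of a i "[]"] by simp
  show aK: "br (a i) x \<in> span (nests a)" if x: "x \<in> K" for x i
  proof -
    obtain c where "br x (a i) = scaleG c (a i)" using Ka[OF x] by blast
    then show ?thesis using br_anti[of "a i" x] by (simp add: span_neg span_scale span_base gen)
  qed
  show KN: "br x (nest a (a r) v) \<in> span (nests a)" if x: "x \<in> K" for x r v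
  proof (induction v rule: rev_induct)
    case Nil
    then show ?case using aK[OF x, of r] br_anti[of x "a r"] by (simp add: span_neg)
  next
    case (snoc i v)
    obtain c where c: "br x (a i) = scaleG c (a i)" using Ka[OF x] by blast
    have "br x (nest a (a r) (v @ [i])) =
        scaleG c (br (a i) (nest a (a r) v)) + br (a i) (br x (nest a (a r) v))"
      by (simp add: br_deriv[of x "a i"] c br_scale_left)
    then show ?case
      using snoc by (simp add: span_add span_scale span_base br_nests nestsI br_span_nests)
  qed
  show "br (b j) (nest a (a r) v) \<in> span (nests a \<union> K)"
  proof (induction v rule: rev_induct)
    case Nil
    then show ?case using ba by (simp add: span_base)
  next
    case (snoc i v)
    have "br (br (b j) (a i)) (nest a (a r) v) \<in> span (nests a \<union> K)"
      using KN[OF ba] span_mono[of "nests a" "nests a \<union> K"] by auto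
    moreover have "br (a i) (br (b j) (nest a (a r) v)) \<in> span (nests a)"
      by (rule br_span_right[OF snoc]) (auto intro: span_base br_nests aK)
    ultimately show ?case
      using span_mono[of "nests a" "nests a \<union> K"] by (simp add: br_deriv[of "b j" "a i"] span_add subsetD)
  qed
qed

section \<open>Choosing the innermost letter\<close>

definition nest_span :: "('v \<Rightarrow> 'g) \<Rightarrow> 'v \<Rightarrow> 'v multiset \<Rightarrow> 'g set" where
  "nest_span a r \<beta> = span {nest a (a r) u | u. mset (r # u) = \<beta>}"

lemma subspace_nest_span: "subspace (nest_span a r \<beta>)"
  by (simp add: nest_span_def)

lemma br_nest_span:
  assumes "y \<in> nest_span a r \<beta>"
  shows "br (a i) y \<in> nest_span a r (add_mset i \<beta>)"
  using assms unfolding nest_span_def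
proof (rule br_span_right)
  fix m assume "m \<in> {nest a (a r) u | u. mset (r # u) = \<beta>}"
  then obtain u where "m = nest a (a r) u" "mset (r # u) = \<beta>" by blast
  then have "br (a i) m = nest a (a r) (u @ [i])" "mset (r # u @ [i]) = add_mset i \<beta>" by auto
  then show "br (a i) m \<in> span {nest a (a r) u | u. mset (r # u) = add_mset i \<beta>}"
    by (intro span_base) blast
qed simp

text \<open>By the Jacobi identity, bracketing with a nested bracket is a combination of
  compositions of the maps \<open>br (a i)\<close>. Each of these adds an outer letter and leaves
  the innermost \<open>r\<close> in place.\<close>

lemma br_nest_nest_span:
  assumes "y \<in> nest_span a r \<beta>"
  shows "br (nest a (a s) v) y \<in> nest_span a r (mset (s # v) + \<beta>)"
  using assms
proof (induction v arbitrary: y \<beta> rule: rev_induct)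
  case Nil
  then show ?case using br_nest_span by simp
next
  case (snoc i v)
  have "br (a i) (br (nest a (a s) v) y) \<in> nest_span a r (mset (s # v @ [i]) + \<beta>)"
    using br_nest_span[OF snoc.IH[OF snoc.prems], of i] by (simp add: add_mset_commute)
  moreover have "br (nest a (a s) v) (br (a i) y) \<in> nest_span a r (mset (s # v @ [i]) + \<beta>)"
    using snoc.IH[OF br_nest_span[OF snoc.prems], of i] by (simp add: add_mset_commute)
  ultimately show ?case using subspace_diff[OF subspace_nest_span] by (simp add: br_br_left)
qed

text \<open>Any letter of a nested bracket can be moved to the innermost position.\<close>

lemma nest_in_nest_span:
  assumes "r \<in> set (s # v)"
  shows "nest a (a s) v \<in> nest_span a r (mset (s # v))"
  using assms
proof (induction v rule: rev_induct)
  case Nil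
  then show ?case by (auto simp: nest_span_def intro!: span_base exI[of _ "[]"])
next
  case (snoc i v)
  show ?case
  proof (cases "r \<in> set (s # v)")
    case True
    then show ?thesis using br_nest_span[OF snoc.IH, of i] by (simp add: add_mset_commute)
  next
    case False
    \<comment> \<open>Here \<open>r\<close> is the outermost letter; antisymmetry makes
      \<open>a r\<close> the right argument, from where the previous lemma applies.\<close>
    then have "i = r" using snoc.prems by auto
    have "a r \<in> nest_span a r {#r#}"
      by (auto simp: nest_span_def intro!: span_base exI[of _ "[]"])
    then have "br (nest a (a s) v) (a r) \<in> nest_span a r (mset (s # v) + {#r#})"
      by (rule br_nest_nest_span)
    then show ?thesis
      using \<open>i = r\<close> br_anti[of "a r" "nest a (a s) v"] subspace_neg[OF subspace_nest_span]
      by (simp add: add_mset_commute)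
  qed
qed

section \<open>Spans of weight vectors\<close>

lemma subspace_root_space: "subspace (root_space scaleG br \<iota> \<phi>)"
  by (auto simp: subspace_def root_space_def br_add_right br_scale_right scale_right_distrib mult.commute)

lemma root_space_unique:
  assumes "m \<in> root_space scaleG br \<iota> \<phi>" "m \<in> root_space scaleG br \<iota> \<psi>" "m \<noteq> 0"
  shows "\<phi> = \<psi>"
proof
  fix x
  have "scaleG (\<phi> x) m = scaleG (\<psi> x) m" using assms by (auto simp: root_space_def)
  then show "\<phi> x = \<psi> x" using assms(3) by simp
qed

text \<open>Applying \<open>ad x - \<psi> x\<close> eliminates the vectors of weight \<open>\<psi>\<close>.\<close>

lemma root_space_span:
  assumes M: "\<And>m. m \<in> M \<Longrightarrow> \<exists>\<psi>. m \<in> root_space scaleG br \<iota> \<psi>"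
    and y: "y \<in> span M" "y \<in> root_space scaleG br \<iota> \<phi>"
  shows "y \<in> span {m \<in> M. m \<in> root_space scaleG br \<iota> \<phi>}"
proof -
  obtain F c where F: "finite F" "F \<subseteq> M" "y = (\<Sum>m\<in>F. scaleG (c m) m)"
    using y(1) unfolding span_explicit by blast
  obtain wtf where wtf: "\<And>m. m \<in> M \<Longrightarrow> m \<in> root_space scaleG br \<iota> (wtf m)" using M by metis
  have "y \<in> span {m \<in> F. m \<in> root_space scaleG br \<iota> \<phi>}"
    using F
  proof (induction "card {m \<in> F. m \<notin> root_space scaleG br \<iota> \<phi>}" arbitrary: F c)
    case 0
    then have "{m \<in> F. m \<in> root_space scaleG br \<iota> \<phi>} = F" by auto
    then show ?case using 0 by (simp add: span_sum span_scale span_base)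
  next
    case (Suc n)
    then obtain k where k: "k \<in> F" "k \<notin> root_space scaleG br \<iota> \<phi>"
      by (metis (mono_tags, lifting) card_eq_0_iff empty_Collect_eq nat.distinct(1))
    then have "wtf k \<noteq> \<phi>" using wtf Suc.prems(2) by blast
    then obtain x where x: "wtf k x \<noteq> \<phi> x" by blast
    \<comment> \<open>Subtracting \<open>wtf k x\<close> from the map \<open>br (\<iota> x)\<close>
      gives an operator that multiplies \<open>y\<close> by \<open>d\<close> and annihilates
      \<open>k\<close>. Dividing by \<open>d\<close> rewrites \<open>y\<close> without
      \<open>k\<close>.\<close>
    define d where "d = \<phi> x - wtf k x"
    have d: "d \<noteq> 0" using x by (simp add: d_def)
    have brm: "br (\<iota> x) m = scaleG (wtf m x) m" if "m \<in> F" for m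
      using wtf[of m] that Suc.prems(2) by (auto simp: root_space_def)
    have br_sum: "br (\<iota> x) (\<Sum>m\<in>G. scaleG (c m) m) = (\<Sum>m\<in>G. scaleG (c m) (br (\<iota> x) m))"
      if "finite G" for G
      using that by (induction G) (simp_all add: br_add_right br_scale_right)
    have "scaleG d y = br (\<iota> x) y - scaleG (wtf k x) y"
      using y(2) by (simp add: d_def root_space_def scale_left_diff_distrib)
    also have "\<dots> = (\<Sum>m\<in>F. scaleG (c m * (wtf m x - wtf k x)) m)"
      unfolding Suc.prems(3) br_sum[OF Suc.prems(1)] scale_sum_right sum_subtractf[symmetric]
      by (rule sum.cong) (simp_all add: brm algebra_simps)
    also have "\<dots> = (\<Sum>m\<in>F - {k}. scaleG (c m * (wtf m x - wtf k x)) m)"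
      using Suc.prems(1) k(1) by (subst sum.remove[of _ k]) auto
    finally have "scaleG (inverse d) (scaleG d y) =
        (\<Sum>m\<in>F - {k}. scaleG (inverse d * (c m * (wtf m x - wtf k x))) m)"
      by (simp add: scale_sum_right)
    then have y': "y = (\<Sum>m\<in>F - {k}. scaleG (inverse d * (c m * (wtf m x - wtf k x))) m)"
      using d by simp
    have "{m \<in> F. m \<notin> root_space scaleG br \<iota> \<phi>} =
        insert k {m \<in> F - {k}. m \<notin> root_space scaleG br \<iota> \<phi>}" using k by auto
    then have "n = card {m \<in> F - {k}. m \<notin> root_space scaleG br \<iota> \<phi>}"
      using Suc.hyps(2) Suc.prems(1) by simp
    from Suc.hyps(1)[OF this _ _ y'] Suc.prems
    have "y \<in> span {m \<in> F - {k}. m \<in> root_space scaleG br \<iota> \<phi>}" by auto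
    then show ?case using span_mono[of "{m \<in> F - {k}. m \<in> root_space scaleG br \<iota> \<phi>}"
        "{m \<in> F. m \<in> root_space scaleG br \<iota> \<phi>}"] by blast
  qed
  then show ?thesis using F(2) span_mono[of "{m \<in> F. m \<in> root_space scaleG br \<iota> \<phi>}"
        "{m \<in> M. m \<in> root_space scaleG br \<iota> \<phi>}"] by blast
qed

text \<open>Words of the same orientation differ by transpositions of adjacent commuting letters.\<close>

lemma nest_move:
  assumes comm: "\<And>i j. i \<noteq> j \<Longrightarrow> \<not> E i j \<Longrightarrow> br (a i) (a j) = 0"
    and p: "\<forall>j\<in>set p. \<not> E j i \<and> i \<noteq> j"
  shows "nest a x (p @ i # q) = nest a x (i # p @ q)"
  using p
proof (induction p arbitrary: x)
  case (Cons j p)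
  then have "br (a j) (a i) = 0" using comm by auto
  then have "br (a i) (br (a j) x) = br (a j) (br (a i) x)"
    using br_deriv[of "a j" "a i" x] by simp
  then show ?case using Cons by simp
qed simp

text \<open>The first letter \<open>i\<close> of \<open>u\<close> has no neighbour before it in
  \<open>u'\<close>, since such an edge would have opposite directions in the two words. So
  \<open>i\<close> can be moved to the front of \<open>u'\<close>, and deleting it leaves shorter
  words of equal orientation. The inner element \<open>x\<close> varies in the induction because it
  absorbs \<open>i\<close>.\<close>

lemma nest_orient_cong:
  assumes comm: "\<And>i j. i \<noteq> j \<Longrightarrow> \<not> E i j \<Longrightarrow> br (a i) (a j) = 0"
    and "distinct u" "distinct u'" "set u = set u'" "orient E u = orient E u'"
  shows "nest a x u = nest a x u'"
  using assms(2-)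
proof (induction u arbitrary: u' x)
  case (Cons i w)
  then obtain p q where pq: "u' = p @ i # q" by (metis list.set_intros(1) split_list)
  have dist: "i \<notin> set p" "i \<notin> set q" "i \<notin> set w" using Cons.prems(1,2) pq by auto
  have "\<not> E j i" if "j \<in> set p" for j
  proof
    assume "E j i"
    then have "(j, i) \<in> orient E (i # w)" using Cons.prems(4) that pq by (auto simp: orient_append)
    then have "i \<in> set w" using that dist(1) orient_subset[of E w] by auto
    then show False using dist by simp
  qed
  then have move: "nest a x u' = nest a x (i # p @ q)"
    unfolding pq using dist(1) by (intro nest_move[OF comm]) auto
  have flt: "filter (\<lambda>j. j \<noteq> i) w = w" "filter (\<lambda>j. j \<noteq> i) p = p" "filter (\<lambda>j. j \<noteq> i) q = q"
    unfolding filter_id_conv using dist by auto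
  have "filter (\<lambda>j. j \<noteq> i) (i # w) = w" "filter (\<lambda>j. j \<noteq> i) u' = p @ q"
    using flt pq by auto
  then have "orient E w = orient E (p @ q)"
    using Cons.prems(4) orient_filter[of E "\<lambda>j. j \<noteq> i" "i # w"] orient_filter[of E "\<lambda>j. j \<noteq> i" u'] by metis
  moreover have "set w = set (p @ q)" using Cons.prems(3) pq dist by (auto simp: set_eq_iff)
  ultimately have "nest a (br (a i) x) w = nest a (br (a i) x) (p @ q)"
    using Cons.IH[of "p @ q"] Cons.prems(1,2) pq by simp
  then show ?case using move by simp
qed simp

text \<open>A source \<open>v\<close> other than \<open>r\<close> commutes with all letters before
  it and can be moved next to the innermost \<open>a r\<close>, with which it also commutes.\<close>

lemma nest_two_sources:
  assumes comm: "\<And>i j. i \<noteq> j \<Longrightarrow> \<not> E i j \<Longrightarrow> br (a i) (a j) = 0"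
    and "distinct (r # u)" and v: "v \<in> set u" "\<And>j. (j, v) \<notin> orient E (r # u)"
  shows "nest a (a r) u = 0"
proof -
  obtain p q where u: "u = p @ v # q" using v(1) by (metis split_list)
  have "\<forall>j\<in>set p. \<not> E j v \<and> v \<noteq> j"
    using v(2) assms(2) u by (auto simp: orient_append)
  then have "nest a (a r) u = nest a (a r) (v # p @ q)" unfolding u by (intro nest_move[OF comm]) auto
  moreover have "br (a v) (a r) = 0"
  proof -
    have "\<not> E r v" using v(2)[of r] v(1) by auto
    then have "br (a r) (a v) = 0" using comm[of r v] v(1) assms(2) by auto
    then show ?thesis using br_anti[of "a v" "a r"] by simp
  qed
  ultimately show ?thesis by simp
qed

end

section \<open>The triangular decomposition\<close>

locale kac_moody = realization E scaleH \<alpha> h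
  for E :: "'v::finite \<Rightarrow> 'v \<Rightarrow> bool"
    and scaleH :: "complex \<Rightarrow> 'h::ab_group_add \<Rightarrow> 'h"
    and \<alpha> :: "'v \<Rightarrow> 'h \<Rightarrow> complex" and h :: "'v \<Rightarrow> 'h" +
  fixes scaleG :: "complex \<Rightarrow> 'g::ab_group_add \<Rightarrow> 'g"
    and br :: "'g \<Rightarrow> 'g \<Rightarrow> 'g"
    and \<iota> :: "'h \<Rightarrow> 'g" and e f :: "'v \<Rightarrow> 'g"
  assumes presentation:
    "lie_presentation scaleG br (case_km_gen \<iota> e f) (chevalley_serre_relations (cartan_matrix E) scaleH \<alpha> h)"
begin

sublocale lie_algebra scaleG br
  using presentation by (simp add: lie_presentation_def)

abbreviation "relations \<equiv> chevalley_serre_relations (cartan_matrix E) scaleH \<alpha> h"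
abbreviation "ev \<equiv> lie_eval scaleG br (case_km_gen \<iota> e f)"

lemma ev_surj: "\<exists>s. ev s = y"
  using presentation unfolding lie_presentation_def by (metis surj_def)

lemma ev_eq_iff: "ev s = ev t \<longleftrightarrow> lie_derivable relations s t"
  using presentation by (simp add: lie_presentation_def)

lemma ev_rel: "(s, t) \<in> relations \<Longrightarrow> ev s = ev t"
  by (simp add: ev_eq_iff lie_derivable.rel)

lemma \<iota>_add: "\<iota> (x + y) = \<iota> x + \<iota> y"
  and \<iota>_scale: "\<iota> (scaleH c x) = scaleG c (\<iota> x)"
  and br_\<iota>_\<iota>: "br (\<iota> x) (\<iota> y) = 0"
  and br_\<iota>_e: "br (\<iota> x) (e i) = scaleG (\<alpha> i x) (e i)"
  and br_\<iota>_f: "br (\<iota> x) (f i) = scaleG (- \<alpha> i x) (f i)"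
  and br_e_f: "br (e i) (f j) = (if i = j then \<iota> (h i) else 0)"
  using ev_rel[OF H_add[where x = x and y = y]] ev_rel[OF H_scale[where c = c and x = x]]
    ev_rel[OF HH[where x = x and y = y]] ev_rel[OF HE[where x = x and i = i]]
    ev_rel[OF HF[where x = x and i = i]] ev_rel[OF EF[where i = i and j = j]]
  by (auto split: if_splits)

lemma br_e_e:
  assumes "i \<noteq> j" "\<not> E i j"
  shows "br (e i) (e j) = 0"
  using ev_rel[OF serre_E[OF assms(1)]] assms by (simp add: cartan_matrix_nth[OF graph])

lemma subspace_range_\<iota>: "subspace (range \<iota>)"
  unfolding subspace_def
proof (intro conjI allI ballI)
  have "\<iota> 0 = 0" using \<iota>_add[of 0 0] by simp
  then show "0 \<in> range \<iota>" using rangeI[of \<iota> 0] by simp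
  show "x + y \<in> range \<iota>" if "x \<in> range \<iota>" "y \<in> range \<iota>" for x y
    using that by (auto simp flip: \<iota>_add)
  show "scaleG c x \<in> range \<iota>" if "x \<in> range \<iota>" for c x
    using that by (auto simp flip: \<iota>_scale)
qed

definition triangular :: "'g set" where
  "triangular = span (nests e \<union> range \<iota> \<union> nests f)"

lemma triangular_stable:
  shows "x \<in> range \<iota> \<Longrightarrow> y \<in> triangular \<Longrightarrow> br x y \<in> triangular"
    and "y \<in> triangular \<Longrightarrow> br (e i) y \<in> triangular"
    and "y \<in> triangular \<Longrightarrow> br (f i) y \<in> triangular"
proof -
  have sub: "span (nests e) \<subseteq> triangular" "span (nests f) \<subseteq> triangular"
    "span (nests e \<union> range \<iota>) \<subseteq> triangular" "span (nests f \<union> range \<iota>) \<subseteq> triangular"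
    unfolding triangular_def by (intro span_mono; blast)+
  have \<iota>e: "\<exists>c. br x (e i) = scaleG c (e i)" if "x \<in> range \<iota>" for x i
    using that br_\<iota>_e by blast
  have \<iota>f: "\<exists>c. br x (f i) = scaleG c (f i)" if "x \<in> range \<iota>" for x i
    using that br_\<iota>_f by blast
  have ef: "br (e i) (f j) \<in> range \<iota>" for i j
    using subspace_0[OF subspace_range_\<iota>] by (simp add: br_e_f)
  have fe: "br (f j) (e i) \<in> range \<iota>" for i j
    using subspace_neg[OF subspace_range_\<iota> ef] br_anti by metis
  note e_st = nests_stable[where a = e and b = f, OF subspace_range_\<iota> \<iota>e fe]
  note f_st = nests_stable[where a = f and b = e, OF subspace_range_\<iota> \<iota>f ef]
  have T: "subspace triangular" by (simp add: triangular_def)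
  have gen: "y \<in> triangular" if "y \<in> nests e \<union> range \<iota> \<union> nests f" for y
    using that by (simp add: triangular_def span_base)
  have cases: "(\<exists>r v. m = nest e (e r) v) \<or> m \<in> range \<iota> \<or> (\<exists>r v. m = nest f (f r) v)"
    if "m \<in> nests e \<union> range \<iota> \<union> nests f" for m
    using that by (auto simp: nests_def)
  show "br x y \<in> triangular" if x: "x \<in> range \<iota>" and y: "y \<in> triangular" for x y
  proof (rule br_span_right[OF y[unfolded triangular_def] T])
    fix m assume "m \<in> nests e \<union> range \<iota> \<union> nests f"
    from cases[OF this] show "br x m \<in> triangular"
    proof (elim disjE exE)
      fix r v assume "m = nest e (e r) v"
      then show ?thesis using e_st(1)[OF _ x] sub by auto
    next
      assume "m \<in> range \<iota>"
      then have "br x m = 0" using x br_\<iota>_\<iota> by auto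
      then show ?thesis using subspace_0[OF T] by simp
    next
      fix r v assume "m = nest f (f r) v"
      then show ?thesis using f_st(1)[OF _ x] sub by auto
    qed
  qed
  show "br (e i) y \<in> triangular" if y: "y \<in> triangular" for y i
  proof (rule br_span_right[OF y[unfolded triangular_def] T])
    fix m assume "m \<in> nests e \<union> range \<iota> \<union> nests f"
    from cases[OF this] show "br (e i) m \<in> triangular"
    proof (elim disjE exE)
      fix r v assume "m = nest e (e r) v"
      then show ?thesis using br_nests[OF nestsI, of e i r v] gen by auto
    next
      assume "m \<in> range \<iota>"
      then show ?thesis using e_st(3) sub by auto
    next
      fix r v assume "m = nest f (f r) v"
      then show ?thesis using f_st(2) sub by auto
    qed
  qed
  show "br (f i) y \<in> triangular" if y: "y \<in> triangular" for y i
  proof (rule br_span_right[OF y[unfolded triangular_def] T])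
    fix m assume "m \<in> nests e \<union> range \<iota> \<union> nests f"
    from cases[OF this] show "br (f i) m \<in> triangular"
    proof (elim disjE exE)
      fix r v assume "m = nest e (e r) v"
      then show ?thesis using e_st(2) sub by auto
    next
      assume "m \<in> range \<iota>"
      then show ?thesis using f_st(3) sub by auto
    next
      fix r v assume "m = nest f (f r) v"
      then show ?thesis using br_nests[OF nestsI, of f i r v] gen by auto
    qed
  qed
qed

text \<open>A subspace that contains the generators and is stable under bracketing with them is
  everything: stability passes to brackets of expressions by the Jacobi identity.\<close>

lemma triangular_UNIV: "y \<in> triangular"
proof -
  have T: "subspace triangular" by (simp add: triangular_def)
  have stable: "br (ev s) y \<in> triangular" if "y \<in> triangular" for s y
    using that
  proof (induction s arbitrary: y)
    case (Gen g)
    then show ?case by (cases g) (auto intro: triangular_stable)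
  next
    case (LBr s t)
    then show ?case by (simp add: br_br_left subspace_diff[OF T])
  qed (auto simp: br_add_left br_scale_left subspace_0[OF T] subspace_add[OF T] subspace_scale[OF T])
  have "ev s \<in> triangular" for s
  proof (induction s)
    case (Gen g)
    have "e i \<in> nests e" "f i \<in> nests f" for i
      using nestsI[of e i "[]"] nestsI[of f i "[]"] by auto
    then show ?case by (cases g) (auto simp: triangular_def intro!: span_base)
  next
    case (LBr s t)
    then show ?case using stable by simp
  qed (auto simp: subspace_0[OF T] subspace_add[OF T] subspace_scale[OF T])
  then show ?thesis using ev_surj by metis
qed

section \<open>Weights of brackets and the positive root spaces\<close>

lemma root_functional_add_mset:
  "root_functional \<alpha> (add_mset i \<beta>) x = \<alpha> i x + root_functional \<alpha> \<beta> x"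
  by (simp add: root_functional_def)

lemma root_functional_count:
  "root_functional \<alpha> \<beta> x = (\<Sum>i\<in>UNIV. of_nat (count \<beta> i) * \<alpha> i x)"
proof (induction \<beta>)
  case (add i \<beta>)
  have "(\<Sum>j\<in>UNIV. of_nat (count (add_mset i \<beta>) j) * \<alpha> j x) =
    (\<Sum>j\<in>UNIV. (if j = i then \<alpha> j x else 0) + of_nat (count \<beta> j) * \<alpha> j x)"
    by (rule sum.cong) (auto simp: algebra_simps)
  also have "\<dots> = \<alpha> i x + root_functional \<alpha> \<beta> x"
    by (simp add: sum.distrib add.IH)
  finally show ?case by (simp add: root_functional_add_mset)
qed (simp add: root_functional_def)

lemma \<alpha>_independent: "(\<And>x. (\<Sum>i\<in>UNIV. c i * \<alpha> i x) = 0) \<Longrightarrow> c i = 0"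
  using min_real unfolding minimal_realization_def by metis

lemma root_functional_inj:
  assumes "\<And>x. root_functional \<alpha> \<beta> x = root_functional \<alpha> \<gamma> x"
  shows "\<beta> = \<gamma>"
proof (rule multiset_eqI)
  fix i
  have "(of_nat (count \<beta> i) - of_nat (count \<gamma> i) :: complex) = 0"
    by (rule \<alpha>_independent[of "\<lambda>i. of_nat (count \<beta> i) - of_nat (count \<gamma> i)"])
      (use assms in \<open>simp add: root_functional_count left_diff_distrib sum_subtractf\<close>)
  then show "count \<beta> i = count \<gamma> i" by simp
qed

text \<open>Multiplicities are nonnegative, so nothing can cancel in \<beta> + \<gamma>. This keeps
  brackets of the f out of the positive root spaces.\<close>

lemma root_functional_neg:
  assumes "\<And>x. root_functional \<alpha> \<beta> x = - root_functional \<alpha> \<gamma> x"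
  shows "\<beta> = {#}"
proof -
  have "root_functional \<alpha> (\<beta> + \<gamma>) x = root_functional \<alpha> {#} x" for x
    using assms[of x] by (simp add: root_functional_def)
  then have "\<beta> + \<gamma> = {#}" by (rule root_functional_inj)
  then show ?thesis by simp
qed

lemma nest_e_root_space:
  "nest e (e r) v \<in> root_space scaleG br \<iota> (root_functional \<alpha> (mset (r # v)))"
proof (induction v rule: rev_induct)
  case Nil
  then show ?case by (simp add: root_space_def br_\<iota>_e root_functional_def)
next
  case (snoc i v)
  show ?case unfolding root_space_def
  proof (intro CollectI allI)
    fix x
    have "br (\<iota> x) (nest e (e r) v) = scaleG (root_functional \<alpha> (mset (r # v)) x) (nest e (e r) v)"
      using snoc by (simp add: root_space_def)
    then have "br (\<iota> x) (nest e (e r) (v @ [i])) =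
        scaleG (\<alpha> i x + root_functional \<alpha> (mset (r # v)) x) (nest e (e r) (v @ [i]))"
      unfolding nest_snoc br_deriv[of "\<iota> x" "e i"] scale_left_distrib
      by (simp only: br_\<iota>_e br_scale_left br_scale_right)
    then show "br (\<iota> x) (nest e (e r) (v @ [i])) =
        scaleG (root_functional \<alpha> (mset (r # v @ [i])) x) (nest e (e r) (v @ [i]))"
      by (simp add: root_functional_add_mset algebra_simps)
  qed
qed

lemma nest_f_root_space:
  "nest f (f r) v \<in> root_space scaleG br \<iota> (\<lambda>x. - root_functional \<alpha> (mset (r # v)) x)"
proof (induction v rule: rev_induct)
  case Nil
  then show ?case by (simp add: root_space_def br_\<iota>_f root_functional_def)
next
  case (snoc i v)
  show ?case unfolding root_space_def
  proof (intro CollectI allI)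
    fix x
    have "br (\<iota> x) (nest f (f r) v) = scaleG (- root_functional \<alpha> (mset (r # v)) x) (nest f (f r) v)"
      using snoc by (simp add: root_space_def)
    then have "br (\<iota> x) (nest f (f r) (v @ [i])) =
        scaleG (- \<alpha> i x + - root_functional \<alpha> (mset (r # v)) x) (nest f (f r) (v @ [i]))"
      unfolding nest_snoc br_deriv[of "\<iota> x" "f i"] scale_left_distrib
      by (simp only: br_\<iota>_f br_scale_left br_scale_right)
    then show "br (\<iota> x) (nest f (f r) (v @ [i])) =
        scaleG (- root_functional \<alpha> (mset (r # v @ [i])) x) (nest f (f r) (v @ [i]))"
      by (simp add: root_functional_add_mset algebra_simps)
  qed
qed

text \<open>The spanning set of the triangular decomposition consists of weight vectors, so a root
  space is spanned by those of its own weight. Linear independence of the simple roots leaves only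
  brackets of the e with content \<beta>.\<close>

lemma root_space_positive:
  assumes "\<beta> \<noteq> {#}"
  shows "root_space scaleG br \<iota> (root_functional \<alpha> \<beta>) =
    span {nest e (e r) v | r v. mset (r # v) = \<beta>}" (is "?R = span ?N")
proof
  have "?N \<subseteq> ?R" using nest_e_root_space by auto
  then show "span ?N \<subseteq> ?R" by (rule span_minimal[OF _ subspace_root_space])
  let ?M = "nests e \<union> range \<iota> \<union> nests f"
  have \<iota>0: "\<iota> x \<in> root_space scaleG br \<iota> (\<lambda>x. 0)" for x
    by (simp add: root_space_def br_\<iota>_\<iota>)
  show "?R \<subseteq> span ?N"
  proof
    fix y assume y: "y \<in> ?R"
    have "\<exists>\<psi>. m \<in> root_space scaleG br \<iota> \<psi>" if "m \<in> ?M" for m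
      using that nest_e_root_space nest_f_root_space \<iota>0 unfolding nests_def by blast
    moreover have "y \<in> span ?M" using triangular_UNIV by (simp add: triangular_def)
    ultimately have y': "y \<in> span {m \<in> ?M. m \<in> ?R}" using y by (rule root_space_span)
    have "{m \<in> ?M. m \<in> ?R} \<subseteq> span ?N"
    proof
      fix m assume m: "m \<in> {m \<in> ?M. m \<in> ?R}"
      show "m \<in> span ?N"
      \<comment> \<open>The zero vector lies in every root space; weights can be compared only for
        nonzero \<open>m\<close>.\<close>
      proof (cases "m = 0")
        case False
        have uniq: "\<And>x. root_functional \<alpha> \<beta> x = \<psi> x" if "m \<in> root_space scaleG br \<iota> \<psi>" for \<psi>
          using root_space_unique[OF _ that False] m by (metis (mono_tags, lifting) mem_Collect_eq)
        consider r v where "m = nest e (e r) v" | x where "m = \<iota> x" | r v where "m = nest f (f r) v"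
          using m by (auto simp: nests_def)
        then show ?thesis
        proof cases
          case 1
          then have "\<beta> = mset (r # v)" using uniq nest_e_root_space root_functional_inj by metis
          then show ?thesis using 1 by (intro span_base) auto
        next
          case 2
          then have "root_functional \<alpha> \<beta> x = root_functional \<alpha> {#} x" for x
            using uniq[of "\<lambda>x. 0" x] \<iota>0 by (simp add: root_functional_def)
          then have "\<beta> = {#}" by (rule root_functional_inj)
          with assms show ?thesis by simp
        next
          case 3
          then have "\<beta> = {#}" using uniq nest_f_root_space root_functional_neg by metis
          with assms show ?thesis by simp
        qed
      qed (simp add: span_zero)
    qed
    from span_minimal[OF this subspace_span] y' show "y \<in> span ?N" by blast
  qed
qed

lemma root_space_nest_span:
  assumes "r \<in># \<beta>"
  shows "root_space scaleG br \<iota> (root_functional \<alpha> \<beta>) = nest_span e r \<beta>"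
proof -
  have \<beta>: "\<beta> \<noteq> {#}" using assms by auto
  have "{nest e (e s) v | s v. mset (s # v) = \<beta>} \<subseteq> nest_span e r \<beta>"
  proof
    fix m assume "m \<in> {nest e (e s) v | s v. mset (s # v) = \<beta>}"
    then obtain s v where m: "m = nest e (e s) v" "mset (s # v) = \<beta>" by blast
    then have "r \<in> set (s # v)" using assms by (metis set_mset_mset)
    then show "m \<in> nest_span e r \<beta>" using nest_in_nest_span[of r s v e] m by simp
  qed
  then have "span {nest e (e s) v | s v. mset (s # v) = \<beta>} \<subseteq> nest_span e r \<beta>"
    by (rule span_minimal[OF _ subspace_nest_span])
  moreover have "nest_span e r \<beta> \<subseteq> span {nest e (e s) v | s v. mset (s # v) = \<beta>}"
    unfolding nest_span_def by (rule span_mono) blast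
  ultimately show ?thesis using root_space_positive[OF \<beta>] by blast
qed

section \<open>Multiplicities of square-free roots\<close>

text \<open>A matrix coefficient of the module. The algebra is an abstract type, so some expression
  for \<open>y\<close> is chosen; for \<phi> in \<open>serre_module\<close> the value does not
  depend on the choice.\<close>

definition coeff_functional :: "('v list \<Rightarrow> complex) \<Rightarrow> 'g \<Rightarrow> complex" where
  "coeff_functional \<phi> y = act (SOME s. ev s = y) \<phi> []"

lemma coeff_functional_ev:
  assumes "\<phi> \<in> serre_module"
  shows "coeff_functional \<phi> (ev s) = act s \<phi> []"
proof -
  have "ev (SOME t. ev t = ev s) = ev s" by (rule someI) simp
  then show ?thesis unfolding coeff_functional_def
    using act_derivable[OF _ assms] ev_eq_iff by metis
qed

lemma coeff_functional_add:
  assumes "\<phi> \<in> serre_module"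
  shows "coeff_functional \<phi> (x + y) = coeff_functional \<phi> x + coeff_functional \<phi> y"
proof -
  obtain s t where st: "ev s = x" "ev t = y" using ev_surj by blast
  show ?thesis using coeff_functional_ev[OF assms, of "LAdd s t"] coeff_functional_ev[OF assms, of s]
    coeff_functional_ev[OF assms, of t] by (simp add: st)
qed

lemma coeff_functional_scale:
  assumes "\<phi> \<in> serre_module"
  shows "coeff_functional \<phi> (scaleG c x) = c * coeff_functional \<phi> x"
proof -
  obtain s where s: "ev s = x" using ev_surj by blast
  show ?thesis using coeff_functional_ev[OF assms, of "LScale c s"] coeff_functional_ev[OF assms, of s]
    by (simp add: s)
qed

primrec nest_expr :: "('h, 'v) km_gen lie_expr \<Rightarrow> 'v list \<Rightarrow> ('h, 'v) km_gen lie_expr" where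
  "nest_expr t [] = t"
| "nest_expr t (i # v) = nest_expr (LBr (genE i) t) v"

lemma ev_nest_expr: "ev (nest_expr t v) = nest e (ev t) v"
  by (induction v arbitrary: t) simp_all

lemma nest_expr_snoc: "nest_expr t (v @ [i]) = LBr (genE i) (nest_expr t v)"
  by (induction v arbitrary: t) simp_all

text \<open>Of all words in the expansion of a bracket, only one starts with the innermost letter.\<close>

lemma act_nest_expr:
  assumes "\<And>w. \<phi> w \<noteq> 0 \<Longrightarrow> w \<noteq> [] \<and> hd w = r" and "r \<notin> set v"
  shows "act (nest_expr (genE r) v) \<phi> w = \<phi> (r # v @ w)"
  using assms(2)
proof (induction v arbitrary: w rule: rev_induct)
  case Nil
  then show ?case by (simp add: opE_def)
next
  case (snoc i v)
  have "opE i \<phi> = (\<lambda>w. 0)" using assms(1)[of "i # _"] snoc.prems by (auto simp: opE_def fun_eq_iff)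
  then show ?case using snoc by (simp add: nest_expr_snoc opE_def[of i "act _ _"] act_zero)
qed

definition class_fun :: "'v set \<Rightarrow> ('v \<times> 'v) set \<Rightarrow> 'v list \<Rightarrow> complex" where
  "class_fun S P w = (if w \<in> permutations_of_set S \<and> orient E w = P then 1 else 0)"

text \<open>For an edge, the words of the Serre element repeat \<open>i\<close> and are never
  permutations of \<open>S\<close>. For a nonedge, the two words have the same letters and the same
  orientation.\<close>

lemma class_fun_serre_module: "class_fun S P \<in> serre_module"
proof -
  have "serre_op i j (\<lambda>v. class_fun S P (u @ v)) w = 0" if "i \<noteq> j" for i j u w
  proof (cases "E i j")
    case True
    then show ?thesis by (simp add: serre_op_def class_fun_def permutations_of_set_def)
  next
    case False
    then have "\<not> E j i" using E_sym by blast
    then have "orient E (u @ i # j # w) = orient E (u @ j # i # w)"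
      using False by (auto simp: orient_append)
    moreover have "u @ i # j # w \<in> permutations_of_set S \<longleftrightarrow> u @ j # i # w \<in> permutations_of_set S"
      by (auto simp: permutations_of_set_def)
    ultimately show ?thesis using False by (simp add: serre_op_def class_fun_def)
  qed
  then show ?thesis by (simp add: serre_module_def)
qed

lemma rooted_orientation_hd:
  assumes "P \<in> rooted_orientations E S r" "w \<in> permutations_of_set S" "orient E w = P" "r \<in> S"
  shows "w \<noteq> [] \<and> hd w = r"
proof -
  have ne: "w \<noteq> []" using assms by (auto simp: permutations_of_set_def)
  then obtain x w' where w: "w = x # w'" by (cases w) auto
  have "(u, x) \<notin> orient E w" for u
    using orient_subset[of E w'] assms(2) w by (auto simp: permutations_of_set_def)
  then have "x \<in> sources S P" using assms w by (auto simp: sources_def permutations_of_set_def)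
  then show ?thesis using assms(1) ne w by (auto simp: rooted_orientations_def)
qed

text \<open>In particular the number of orientations is the same for every \<open>r\<close> in
  \<open>S\<close>, since the left hand side does not mention \<open>r\<close>.\<close>

theorem root_mult_mset_set:
  assumes r: "r \<in> S"
  shows "root_mult \<alpha> scaleG br \<iota> (mset_set S) = card (rooted_orientations E S r)"
proof -
  let ?U = "rooted_orientations E S r"
  have fin: "finite S" by simp
  have perm: "mset w = mset_set S \<longleftrightarrow> w \<in> permutations_of_set S" for w
    using permutations_of_set_altdef[OF fin] by (simp add: permutations_of_multiset_def)
  have "\<exists>u. r # u \<in> permutations_of_set S \<and> orient E (r # u) = P" if P: "P \<in> ?U" for P
  proof -
    obtain w where w: "w \<in> permutations_of_set S" "orient E w = P"
      using P by (auto simp: rooted_orientations_def acyclic_orientations_def)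
    then show ?thesis using rooted_orientation_hd[OF P w r] by (metis list.collapse)
  qed
  then obtain word where word: "\<And>P. P \<in> ?U \<Longrightarrow> r # word P \<in> permutations_of_set S"
    "\<And>P. P \<in> ?U \<Longrightarrow> orient E (r # word P) = P" by metis
  define b where "b P = nest e (e r) (word P)" for P
  have "root_space scaleG br \<iota> (root_functional \<alpha> (mset_set S)) = span (b ` ?U)"
  proof -
    have rw: "root_space scaleG br \<iota> (root_functional \<alpha> (mset_set S)) =
        span {nest e (e r) u | u. r # u \<in> permutations_of_set S}"
      using root_space_nest_span[of r "mset_set S"] r by (simp add: nest_span_def perm del: mset.simps)
    have "nest e (e r) u \<in> span (b ` ?U)" if u: "r # u \<in> permutations_of_set S" for u
    proof (cases "orient E (r # u) \<in> ?U")
      case True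
      let ?P = "orient E (r # u)"
      have du: "distinct (r # u)" "distinct (r # word ?P)" "set (r # u) = S" "set (r # word ?P) = S"
        using u word(1)[OF True] by (auto simp: permutations_of_set_def)
      \<comment> \<open>The innermost letter does not belong to the words compared by
        \<open>nest_orient_cong\<close>; filtering it out restricts the known equality of
        orientations to them.\<close>
      have flt: "filter (\<lambda>j. j \<noteq> r) (r # v) = v" if "distinct (r # v)" for v
        using that by (auto simp: filter_id_conv)
      have "nest e (e r) u = nest e (e r) (word ?P)"
      proof (rule nest_orient_cong[where E = E])
        show "orient E u = orient E (word ?P)"
          using orient_filter[of E "\<lambda>j. j \<noteq> r" "r # u"] orient_filter[of E "\<lambda>j. j \<noteq> r" "r # word ?P"]
            flt[OF du(1)] flt[OF du(2)] word(2)[OF True] by simp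
        show "set u = set (word ?P)"
          using du by (metis Diff_insert_absorb distinct.simps(2) list.simps(15))
        show "distinct u" "distinct (word ?P)" using du(1,2) by simp_all
      qed (rule br_e_e)
      then have "nest e (e r) u = b ?P" by (simp only: b_def)
      then show ?thesis using True by (auto intro: span_base)
    next
      case False
      have "orient E (r # u) \<in> acyclic_orientations E S"
        unfolding acyclic_orientations_def using u by (rule imageI)
      with False obtain v where v: "v \<in> sources S (orient E (r # u))" "v \<noteq> r"
        unfolding rooted_orientations_def by blast
      have "nest e (e r) u = 0"
      proof (rule nest_two_sources[where E = E and v = v])
        show "distinct (r # u)" "v \<in> set u" "(j, v) \<notin> orient E (r # u)" for j
          using u v by (auto simp: sources_def permutations_of_set_def)
      qed (rule br_e_e)
      then show ?thesis by (simp add: span_zero)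
    qed
    then have "span {nest e (e r) u | u. r # u \<in> permutations_of_set S} \<subseteq> span (b ` ?U)"
      by (intro span_minimal) auto
    moreover have "span (b ` ?U) \<subseteq> span {nest e (e r) u | u. r # u \<in> permutations_of_set S}"
      using word(1) by (intro span_mono) (auto simp: b_def)
    ultimately show ?thesis unfolding rw by blast
  qed
  moreover have "dim (span (b ` ?U)) = card ?U"
  \<comment> \<open>The matrix coefficient of \<open>class_fun S P\<close> on \<open>b Q\<close> is
    its value at \<open>r # word Q\<close>, a word of orientation \<open>Q\<close>.\<close>
  proof (rule dim_span_dual_family[where L = "\<lambda>P. coeff_functional (class_fun S P)"])
    fix P Q assume PQ: "P \<in> ?U" "Q \<in> ?U"
    have "r \<notin> set (word Q)" using word(1)[OF PQ(2)] by (auto simp: permutations_of_set_def)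
    moreover have "w \<noteq> [] \<and> hd w = r" if "class_fun S P w \<noteq> 0" for w
      using that rooted_orientation_hd[OF PQ(1) _ _ r] by (auto simp: class_fun_def split: if_splits)
    ultimately have "act (nest_expr (genE r) (word Q)) (class_fun S P) [] = class_fun S P (r # word Q)"
      by (simp add: act_nest_expr)
    moreover have "ev (nest_expr (genE r) (word Q)) = b Q" by (simp add: ev_nest_expr b_def)
    ultimately have "coeff_functional (class_fun S P) (b Q) = class_fun S P (r # word Q)"
      using coeff_functional_ev[OF class_fun_serre_module] by metis
    then show "coeff_functional (class_fun S P) (b Q) = (if P = Q then 1 else 0)"
      using word[OF PQ(2)] by (auto simp: class_fun_def)
  qed (simp_all add: coeff_functional_add coeff_functional_scale class_fun_serre_module)
  ultimately show ?thesis by (simp add: root_mult_def)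
qed

end

section \<open>The partition function and the chromatic polynomial\<close>

text \<open>Two polynomials agreeing at all positive integers have a difference with infinitely many
  roots. Existence is supplied by \<open>p\<close> itself.\<close>

lemma chromatic_poly_eqI:
  assumes "\<And>q. poly p (int q) = int (card (proper_colorings E q))"
  shows "chromatic_poly E = p"
  unfolding chromatic_poly_def
proof (rule the_equality)
  show "\<forall>q>0. poly p (int q) = int (card (proper_colorings E q))" using assms by simp
  fix p' assume p': "\<forall>q>0. poly p' (int q) = int (card (proper_colorings E q))"
  have "int ` {0<..} \<subseteq> {x. poly (p' - p) x = 0}" using p' assms by auto
  moreover have "infinite (int ` {0<..})"
    by (simp add: finite_image_iff inj_on_def infinite_Ioi)
  ultimately have "infinite {x. poly (p' - p) x = 0}" by (rule infinite_super)
  then show "p' = p" using poly_roots_finite[of "p' - p"] by auto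
qed

lemma sum_singleton_mset: "finite A \<Longrightarrow> (\<Sum>i\<in>A. {#i#}) = mset_set A"
  by (induction A rule: finite_induct) simp_all

context kac_moody
begin

lemma root_mult_zero_outside:
  assumes "\<gamma> \<noteq> {#}" "\<gamma> \<notin> positive_roots \<alpha> scaleG br \<iota>"
  shows "root_mult \<alpha> scaleG br \<iota> \<gamma> = 0"
proof -
  have "root_space scaleG br \<iota> (root_functional \<alpha> \<gamma>) = span {}"
    using assms by (auto simp: positive_roots_def)
  then show ?thesis unfolding root_mult_def
    using dim_span_eq_card_independent[OF independent_empty] by (simp only: card.empty)
qed

abbreviation "pos_roots \<equiv> positive_roots \<alpha> scaleG br \<iota>"
abbreviation "small_roots \<equiv> {\<gamma> \<in> pos_roots. \<gamma> \<subseteq># mset_set UNIV}"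

text \<open>One product over the roots below the full vertex set serves all \<open>S\<close>, so the
  recursion stays within a single series.\<close>

definition kostant_coeff :: "'v set \<Rightarrow> int poly" where
  "kostant_coeff S =
    mfps_coeff (\<Prod>\<gamma>\<in>small_roots. kostant_factor (root_mult \<alpha> scaleG br \<iota>) [:0, 1:] \<gamma>) (mset_set S)"

lemma sub_mset_set:
  assumes "\<gamma> \<subseteq># mset_set S" "finite S"
  shows "\<gamma> = mset_set (set_mset \<gamma>)" "set_mset \<gamma> \<subseteq> S" "mset_set S - \<gamma> = mset_set (S - set_mset \<gamma>)"
  using mset_set_eq_plus[OF assms(2) subset_mset.add_diff_inverse[OF assms(1)]] by auto

lemma finite_small_roots: "finite small_roots"
proof (rule finite_subset)
  show "small_roots \<subseteq> range mset_set"
  proof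
    fix \<gamma> assume "\<gamma> \<in> small_roots"
    then have "\<gamma> = mset_set (set_mset \<gamma>)" using sub_mset_set(1)[of \<gamma> UNIV] by simp
    then show "\<gamma> \<in> range mset_set" by (rule range_eqI)
  qed
qed simp

lemma empty_notin_pos_roots: "{#} \<notin> pos_roots"
  by (simp add: positive_roots_def)

text \<open>Every finite set of roots containing \<open>small_roots\<close> gives the same
  coefficient, which is therefore the value of the infinite product.\<close>

lemma q_kostant_eq: "q_kostant \<alpha> scaleG br \<iota> (mset_set UNIV) = kostant_coeff UNIV"
  unfolding q_kostant_def kostant_factor_def[symmetric]
proof (rule mfps_infprod_coeff_eqI[OF finite_small_roots])
  fix F assume F: "finite F" "small_roots \<subseteq> F" "F \<subseteq> pos_roots"
  then have "{\<gamma> \<in> F. \<gamma> \<subseteq># mset_set UNIV} = small_roots" by blast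
  moreover have "{#} \<notin> F" using F empty_notin_pos_roots by blast
  ultimately show "mfps_coeff (prod (kostant_factor (root_mult \<alpha> scaleG br \<iota>) [:0, 1:]) F) (mset_set UNIV) =
      kostant_coeff UNIV"
    using mfps_coeff_prod_restrict[OF F(1), of UNIV] by (simp add: kostant_coeff_def)
qed blast

lemma kostant_coeff_empty: "kostant_coeff {} = 1"
  using mfps_coeff_prod_empty[OF finite_small_roots] empty_notin_pos_roots
  by (simp add: kostant_coeff_def)

lemma kostant_coeff_rec:
  assumes r: "r \<in> S"
  shows "kostant_coeff S = (\<Sum>B | r \<in> B \<and> B \<subseteq> S.
    of_nat (card (rooted_orientations E B r)) * [:0, 1:] * kostant_coeff (S - B))"
proof -
  let ?m = "root_mult \<alpha> scaleG br \<iota>"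
  let ?P = "\<Prod>\<gamma>\<in>small_roots. kostant_factor ?m [:0, 1:] \<gamma>"
  let ?I = "{\<gamma>. \<gamma> \<in> small_roots \<and> r \<in># \<gamma> \<and> \<gamma> \<subseteq># mset_set S}"
  have "kostant_coeff S = (\<Sum>\<gamma>\<in>?I. of_nat (?m \<gamma>) * [:0, 1:] * mfps_coeff ?P (mset_set S - \<gamma>))"
    unfolding kostant_coeff_def
    by (rule mfps_coeff_prod_rec[OF finite_small_roots _ _ r]) (use empty_notin_pos_roots in auto)
  also have "\<dots> = (\<Sum>B | r \<in> B \<and> B \<subseteq> S \<and> mset_set B \<in> pos_roots.
      of_nat (card (rooted_orientations E B r)) * [:0, 1:] * kostant_coeff (S - B))"
  proof (rule sum.reindex_bij_witness[of _ mset_set set_mset])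
    fix \<gamma> assume \<gamma>: "\<gamma> \<in> ?I"
    then have s: "\<gamma> = mset_set (set_mset \<gamma>)" "set_mset \<gamma> \<subseteq> S" "mset_set S - \<gamma> = mset_set (S - set_mset \<gamma>)"
      using sub_mset_set[of \<gamma> S] by auto
    show "mset_set (set_mset \<gamma>) = \<gamma>" using s(1) by simp
    show "set_mset \<gamma> \<in> {B. r \<in> B \<and> B \<subseteq> S \<and> mset_set B \<in> pos_roots}"
      using \<gamma> s(2) by (simp add: s(1)[symmetric])
    have "?m \<gamma> = card (rooted_orientations E (set_mset \<gamma>) r)"
      using root_mult_mset_set[of r "set_mset \<gamma>"] \<gamma> s(1) by simp
    then show "of_nat (card (rooted_orientations E (set_mset \<gamma>) r)) * [:0, 1:] * kostant_coeff (S - set_mset \<gamma>) =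
        of_nat (?m \<gamma>) * [:0, 1:] * mfps_coeff ?P (mset_set S - \<gamma>)"
      by (simp add: kostant_coeff_def s(3))
  next
    fix B assume B: "B \<in> {B. r \<in> B \<and> B \<subseteq> S \<and> mset_set B \<in> pos_roots}"
    show "set_mset (mset_set B) = B" by simp
    have "mset_set B \<subseteq># mset_set S" "mset_set B \<subseteq># mset_set UNIV"
      using B by (auto intro: subset_imp_msubset_mset_set)
    then show "mset_set B \<in> ?I" using B by simp
  qed
  \<comment> \<open>A set \<open>B\<close> that is not a root has multiplicity zero, hence no
    orientation with only source \<open>r\<close>, and its summand vanishes.\<close>
  also have "\<dots> = (\<Sum>B | r \<in> B \<and> B \<subseteq> S.
      of_nat (card (rooted_orientations E B r)) * [:0, 1:] * kostant_coeff (S - B))"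
  proof (rule sum.mono_neutral_left)
    show "\<forall>B\<in>{B. r \<in> B \<and> B \<subseteq> S} - {B. r \<in> B \<and> B \<subseteq> S \<and> mset_set B \<in> pos_roots}.
      of_nat (card (rooted_orientations E B r)) * [:0, 1:] * kostant_coeff (S - B) = 0"
    proof
      fix B assume B: "B \<in> {B. r \<in> B \<and> B \<subseteq> S} - {B. r \<in> B \<and> B \<subseteq> S \<and> mset_set B \<in> pos_roots}"
      then have "mset_set B \<noteq> {#}" "mset_set B \<notin> pos_roots" by (auto simp: mset_set_empty_iff)
      then have "card (rooted_orientations E B r) = 0"
        using root_mult_zero_outside root_mult_mset_set[of r B] B by simp
      then show "of_nat (card (rooted_orientations E B r)) * [:0, 1:] * kostant_coeff (S - B) = 0"
        by (simp only: of_nat_0 mult_zero_left)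
    qed
  qed auto
  finally show ?thesis .
qed

text \<open>Both sides satisfy the same recursion. In the summand of \<open>B\<close>, the sign
  (-1)^|B| and the sign (-1)^|S - B| from the induction hypothesis combine to (-1)^|S|.\<close>

lemma num_colorings_kostant_coeff:
  "int (num_colorings E {..<q} S) = (- 1) ^ card S * poly (kostant_coeff S) (- int q)"
proof (induction S rule: finite_psubset_induct[OF finite])
  case (1 S)
  show ?case
  proof (cases "S = {}")
    case True
    then show ?thesis by (simp add: kostant_coeff_empty)
  next
    case False
    then obtain r where r: "r \<in> S" by blast
    let ?m = "\<lambda>B. int (card (rooted_orientations E B r))"
    have "int (num_colorings E {..<q} S) = (\<Sum>B | r \<in> B \<and> B \<subseteq> S.
        int q * ((- 1) ^ (card B - 1) * ?m B * int (num_colorings E {..<q} (S - B))))"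
      using num_colorings_rec[OF graph _ _ r, of "{..<q}"] by (simp add: sum_distrib_left)
    also have "\<dots> = (\<Sum>B | r \<in> B \<and> B \<subseteq> S.
        (- 1) ^ card S * (?m B * (- int q) * poly (kostant_coeff (S - B)) (- int q)))"
    proof (rule sum.cong)
      fix B assume "B \<in> {B. r \<in> B \<and> B \<subseteq> S}"
      then have B: "r \<in> B" "B \<subseteq> S" by auto
      have "card B = Suc (card B - 1)" using B(1) card_gt_0_iff[of B] by auto
      then have "card S = Suc (card B - 1) + card (S - B)"
        using card_Diff_subset[of B S] card_mono[of S B] B(2) by simp
      then have sign: "(- 1 :: int) ^ card S = - ((- 1) ^ (card B - 1) * (- 1) ^ card (S - B))"
        by (simp add: power_add)
      have "S - B \<subset> S" using B by blast
      then show "int q * ((- 1) ^ (card B - 1) * ?m B * int (num_colorings E {..<q} (S - B))) =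
          (- 1) ^ card S * (?m B * (- int q) * poly (kostant_coeff (S - B)) (- int q))"
        unfolding sign by (simp add: 1)
    qed simp
    also have "\<dots> = (- 1) ^ card S * poly (kostant_coeff S) (- int q)"
      unfolding kostant_coeff_rec[OF r] poly_sum sum_distrib_left by (simp add: mult_ac)
    finally show ?thesis .
  qed
qed

text \<open>The coefficient at -q, up to sign, is a polynomial with the values required of the
  chromatic polynomial. Substituting -q and multiplying by the sign are involutions, so doing both
  again returns the coefficient.\<close>

lemma chromatic_poly_tilde_eq: "chromatic_poly_tilde E = kostant_coeff UNIV"
proof -
  let ?R = "kostant_coeff UNIV"
  have "chromatic_poly E = (- 1) ^ CARD('v) * (?R \<circ>\<^sub>p [:0, - 1:])"
    by (rule chromatic_poly_eqI)
      (simp add: card_proper_colorings num_colorings_kostant_coeff poly_pcompose poly_power)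
  then have "poly (chromatic_poly_tilde E) x = poly ?R x" for x
    by (simp add: chromatic_poly_tilde_def poly_pcompose poly_power flip: mult.assoc power_mult_distrib)
  then show ?thesis by (simp add: poly_eq_poly_eq_iff[symmetric] fun_eq_iff)
qed

end

theorem corollary1p2:
  fixes E :: "'v::finite \<Rightarrow> 'v \<Rightarrow> bool"
    and scaleH :: "complex \<Rightarrow> 'h::ab_group_add \<Rightarrow> 'h"
    and \<alpha> :: "'v \<Rightarrow> 'h \<Rightarrow> complex" and h :: "'v \<Rightarrow> 'h"
    and scaleG :: "complex \<Rightarrow> 'g::ab_group_add \<Rightarrow> 'g"
    and br :: "'g \<Rightarrow> 'g \<Rightarrow> 'g"
    and \<iota> :: "'h \<Rightarrow> 'g" and e f :: "'v \<Rightarrow> 'g"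
  assumes "simple_graph E"
    and "kac_moody_algebra (cartan_matrix E) scaleH \<alpha> h scaleG br \<iota> e f"
  shows "chromatic_poly_tilde E = q_kostant \<alpha> scaleG br \<iota> (\<Sum>i\<in>UNIV. {#i#})"
proof -
  interpret kac_moody E scaleH \<alpha> h scaleG br \<iota> e f
    using assms by unfold_locales (simp_all add: kac_moody_algebra_def)
  show ?thesis by (simp add: sum_singleton_mset q_kostant_eq chromatic_poly_tilde_eq)
qed

end
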